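(* The Poisson algebra $\mathfrak D_n$ is the semiclassical limit of the twisted $q$-Yangian $Y'_q(\mathfrak o_n)$; that is, the defining relations of $\mathfrak D_n$ are the semiclassical limit of the reflection equation. Precisely: put $q=e^{-h}$, so that $R(\lambda,\mu)=(\lambda-\mu)\,1\otimes 1+h\,r(\lambda,\mu)+O(h^2)$ with $$r(\lambda,\mu)=(\lambda+\mu)\sum_{i}E_{ii}\otimes E_{ii}+2\lambda\sum_{i<j}E_{ij}\otimes E_{ji}+2\mu\sum_{i>j}E_{ij}\otimes E_{ji},$$ and let the generators commute up to order $h$, $[\overset{1}{\mathcal G}(\lambda),\overset{2}{\mathcal G}(\mu)]=h\{\overset{1}{\mathcal G}(\lambda)\otimes_,\overset{2}{\mathcal G}(\mu)\}+O(h^2)$. Then the order-$h$ part of the reflection equation is $$\{\overset{1}{\mathcal G}(\lambda)\otimes_,\overset{2}{\mathcal G}(\mu)\}=-\left[\frac{r(\lambda,\mu)}{\lambda-\mu},\overset{1}{\mathcal G}(\lambda)\overset{2}{\mathcal G}(\mu)\right]-\overset{1}{\mathcal G}(\lambda)\frac{r(\lambda^{-1},\mu)^{T_1}}{\lambda^{-1}-\mu}\overset{2}{\mathcal G}(\mu)+\overset{2}{\mathcal G}(\mu)\frac{r(\lambda^{-1},\mu)^{T_1}}{\lambda^{-1}-\mu}\overset{1}{\mathcal G}(\lambda),$$ and this coincides entrywise with the defining bracket of $\mathfrak D_n$: $$\begin{aligned}\{\mathcal G_{j,i}(\lambda),\mathcal G_{p,l}(\mu)\}={}&\Bigl(\epsilon(j-p)-\tfrac{\lambda+\mu}{\lambda-\mu}\Bigr)\mathcal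 G_{p,i}(\lambda)\mathcal G_{j,l}(\mu)+\Bigl(\epsilon(i-l)+\tfrac{\lambda+\mu}{\lambda-\mu}\Bigr)\mathcal G_{p,i}(\mu)\mathcal G_{j,l}(\lambda)\\&+\Bigl(\epsilon(i-p)-\tfrac{1+\lambda\mu}{1-\lambda\mu}\Bigr)\mathcal G_{j,p}(\lambda)\mathcal G_{i,l}(\mu)+\Bigl(\epsilon(j-l)+\tfrac{1+\lambda\mu}{1-\lambda\mu}\Bigr)\mathcal G_{l,i}(\lambda)\mathcal G_{p,j}(\mu).\end{aligned}$$
   Context: $\epsilon$ is the sign function ($\epsilon(0)=0$). $\mathcal G(\lambda)$ is the $n\times n$ matrix of formal series $\mathcal G_{i,j}(\lambda)=\mathcal A^{(0)}_{i,j}+\sum_{k\ge1}G^{(k)}_{i,j}\lambda^{-k}$, where $\mathcal A^{(0)}$ is upper triangular with entries $G^{(0)}_{i,j}$ for $i<j$ and (in the classical limit) units on the diagonal. $\mathfrak D_n$ is the Poisson algebra on the commuting generators $G^{(0)}_{i,j}$ ($i<j$), $G^{(k)}_{i,j}$ ($k\ge 1$, $1\le i,j\le n$) with the bracket displayed last in the claim. The twisted $q$-Yangian $Y'_q(\mathfrak o_n)$ (Molev--Ragoucy--Sorba) is the associative algebra generated by the matrix elements $G^{(k)}_{i,j}$, $1\le i,j\le n$, $k\ge0$, subject to the reflection equation $$R(\lambda,\mu)\overset{1}{\mathcal G}(\lambda)R(\lambda^{-1},\mu)^{T_1}\overset{2}{\mathcal G}(\mu)=\overset{2}{\mathcal G}(\mu)R(\lambda^{-1},\mu)^{T_1}\overset{1}{\mathcal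 G}(\lambda)R(\lambda,\mu),$$ with $$R(\lambda,\mu)=(\lambda-\mu)\sum_{i\ne j}E_{ii}\otimes E_{jj}+(q^{-1}\lambda-q\mu)\sum_iE_{ii}\otimes E_{ii}+(q^{-1}-q)\lambda\sum_{i<j}E_{ij}\otimes E_{ji}+(q^{-1}-q)\mu\sum_{i>j}E_{ij}\otimes E_{ji}.$$ Here $\overset1{\mathcal G}=\mathcal G\otimes1$, $\overset2{\mathcal G}=1\otimes\mathcal G$, $T_1$ is transposition in the first tensor factor, $E_{ij}$ are matrix units. *)

theory Defs
  imports
    "HOL-Analysis.Finite_Cartesian_Product"
    "HOL-Library.Poly_Mapping"
    "HOL-Computational_Algebra.Formal_Laurent_Series"
begin

unbundle fps_syntax
no_notation fps_nth (infixl \<open>$\<close> 75)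

section \<open>Formal series in two spectral parameters\<close>

text \<open>
  Series in \<open>\<lambda>\<close> and \<open>\<mu>\<close> with coefficients in a (possibly noncommutative) ring \<open>A\<close> live in
  the ring \<open>A((\<lambda>\<^sup>-\<^sup>1))((\<mu>\<^sup>-\<^sup>1))\<close>: the inner Laurent variable is \<open>\<lambda>\<^sup>-\<^sup>1\<close>, the outer one is \<open>\<mu>\<^sup>-\<^sup>1\<close>.
  The coefficient of \<open>\<lambda>\<^sup>-\<^sup>k \<mu>\<^sup>-\<^sup>m\<close> in \<open>f\<close> is \<open>f $$ m $$ k\<close>.
\<close>

type_synonym 'a biseries = "'a fls fls"

definition lam :: "'a::ring_1 biseries" where "lam = fls_const fls_X_inv"
definition lam_inv :: "'a::ring_1 biseries" where "lam_inv = fls_const fls_X"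
definition mu :: "'a::ring_1 biseries" where "mu = fls_X_inv"

definition biconst :: "'a::ring_1 \<Rightarrow> 'a biseries" where
  "biconst a = fls_const (fls_const a)"

definition biser :: "(nat \<Rightarrow> nat \<Rightarrow> 'a::ring_1) \<Rightarrow> 'a biseries" where
  "biser c = fps_to_fls (Abs_fps (\<lambda>m. fps_to_fls (Abs_fps (\<lambda>k. c k m))))"

definition ser_lam :: "(nat \<Rightarrow> 'a::ring_1) \<Rightarrow> 'a biseries" where
  "ser_lam c = biser (\<lambda>k m. if m = 0 then c k else 0)"

definition ser_mu :: "(nat \<Rightarrow> 'a::ring_1) \<Rightarrow> 'a biseries" where
  "ser_mu c = biser (\<lambda>k m. if k = 0 then c m else 0)"

text \<open>
  Over \<open>\<complex>\<close> the ring of biseries is a field, so \<open>1/(\<lambda>-\<mu>)\<close> and the like are honest inverses there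
  (for \<open>\<lambda>-\<mu>\<close> this is the expansion in nonnegative powers of \<open>\<lambda>/\<mu>\<close>). They act on biseries over a
  \<open>\<complex>\<close>-algebra, whose structure map is \<open>\<kappa>\<close>, through the coefficientwise map below.  As \<open>\<lambda>-\<mu>\<close> and
  \<open>1-\<lambda>\<mu>\<close> are invertible, all identities are equivalent to those with denominators cleared.
\<close>

definition lift2 :: "(complex \<Rightarrow> 'b::ring_1) \<Rightarrow> complex biseries \<Rightarrow> 'b biseries" where
  "lift2 \<kappa> f = Abs_fls (\<lambda>m. Abs_fls (\<lambda>k. \<kappa> (f $$ m $$ k)))"

section \<open>Matrices and tensor legs\<close>

text \<open>
  The index set \<open>{1..n}\<close> is a finite linearly ordered type \<open>'n\<close>; operators on the tensor square
  are matrices indexed by \<open>'n \<times> 'n\<close>.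
\<close>

type_synonym ('a, 'n) mat1 = "'a ^ 'n ^ 'n"
type_synonym ('a, 'n) mat2 = "'a ^ ('n \<times> 'n) ^ ('n \<times> 'n)"

definition smat :: "'a::ring_1 \<Rightarrow> 'a ^ 'k ^ 'k \<Rightarrow> 'a ^ 'k ^ 'k" where
  "smat c M = (\<chi> a b. c * M $ a $ b)"

definition E :: "'n \<Rightarrow> 'n \<Rightarrow> ('a::ring_1, 'n::finite) mat1" where
  "E i j = (\<chi> a b. if a = i \<and> b = j then 1 else 0)"

definition tensor :: "('a::ring_1, 'n::finite) mat1 \<Rightarrow> ('a, 'n) mat1 \<Rightarrow> ('a, 'n) mat2"
    (infixr \<open>\<otimes>\<close> 71) where
  "M \<otimes> N = (\<chi> a b. M $ fst a $ fst b * N $ snd a $ snd b)"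

definition T1 :: "('a, 'n::finite) mat2 \<Rightarrow> ('a, 'n) mat2" where
  "T1 M = (\<chi> a b. M $ (fst b, snd a) $ (fst a, snd b))"

definition G1 :: "(nat \<Rightarrow> ('a::ring_1, 'n::finite) mat1) \<Rightarrow> ('a biseries, 'n) mat2" where
  "G1 G = (\<chi> i j. ser_lam (\<lambda>k. G k $ i $ j)) \<otimes> mat 1"

definition G2 :: "(nat \<Rightarrow> ('a::ring_1, 'n::finite) mat1) \<Rightarrow> ('a biseries, 'n) mat2" where
  "G2 G = mat 1 \<otimes> (\<chi> i j. ser_mu (\<lambda>k. G k $ i $ j))"

section \<open>The \<open>R\<close>-matrix, its semiclassical part, and the reflection equation\<close>

text \<open>The arguments \<open>q\<close>, \<open>q'\<close> stand for \<open>q\<close>, \<open>q\<^sup>-\<^sup>1\<close>, and \<open>l\<close>, \<open>m\<close> for the spectral parameters.\<close>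

definition Rmat :: "'r \<Rightarrow> 'r \<Rightarrow> 'r \<Rightarrow> 'r \<Rightarrow> ('r::ring_1, 'n::{finite,linorder}) mat2" where
  "Rmat q q' l m =
     smat (l - m) (\<Sum>i\<in>UNIV. \<Sum>j\<in>{j. i \<noteq> j}. E i i \<otimes> E j j)
   + smat (q' * l - q * m) (\<Sum>i\<in>UNIV. E i i \<otimes> E i i)
   + smat ((q' - q) * l) (\<Sum>i\<in>UNIV. \<Sum>j\<in>{j. i < j}. E i j \<otimes> E j i)
   + smat ((q' - q) * m) (\<Sum>i\<in>UNIV. \<Sum>j\<in>{j. i > j}. E i j \<otimes> E j i)"

definition rmat :: "'r \<Rightarrow> 'r \<Rightarrow> ('r::ring_1, 'n::{finite,linorder}) mat2" where
  "rmat l m =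
     smat (l + m) (\<Sum>i\<in>UNIV. E i i \<otimes> E i i)
   + smat (2 * l) (\<Sum>i\<in>UNIV. \<Sum>j\<in>{j. i < j}. E i j \<otimes> E j i)
   + smat (2 * m) (\<Sum>i\<in>UNIV. \<Sum>j\<in>{j. i > j}. E i j \<otimes> E j i)"

text \<open>
  From here on the ground ring is \<open>\<complex>[[h]]\<close>, \<open>h\<close> is \<open>fps_X\<close>, \<open>q = e\<^sup>-\<^sup>h\<close>, and \<open>\<iota>\<close> is the structure
  map of a \<open>\<complex>[[h]]\<close>-algebra.
\<close>

definition R :: "(complex fps \<Rightarrow> 'a::ring_1) \<Rightarrow> 'a biseries \<Rightarrow> 'a biseries
    \<Rightarrow> ('a biseries, 'n::{finite,linorder}) mat2" where
  "R \<iota> l m = Rmat (biconst (\<iota> (fps_exp (-1)))) (biconst (\<iota> (fps_exp 1))) l m"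

text \<open>Left hand side minus right hand side of the reflection equation.\<close>

definition RE_defect :: "(complex fps \<Rightarrow> 'a::ring_1) \<Rightarrow> (nat \<Rightarrow> ('a, 'n::{finite,linorder}) mat1)
    \<Rightarrow> ('a biseries, 'n) mat2" where
  "RE_defect \<iota> G =
     R \<iota> lam mu ** G1 G ** T1 (R \<iota> lam_inv mu) ** G2 G
   - G2 G ** T1 (R \<iota> lam_inv mu) ** G1 G ** R \<iota> lam mu"

definition O_h :: "(complex fps \<Rightarrow> 'a::ring_1) \<Rightarrow> nat \<Rightarrow> 'a biseries ^ 'k ^ 'k \<Rightarrow> bool" where
  "O_h \<iota> e M \<longleftrightarrow> (\<forall>a b s r. \<exists>c. M $ a $ b $$ s $$ r = \<iota> fps_X ^ e * c)"

section \<open>Classical limits\<close>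

definition unital_hom :: "('a::ring_1 \<Rightarrow> 'b::ring_1) \<Rightarrow> bool" where
  "unital_hom f \<longleftrightarrow> f 1 = 1 \<and> (\<forall>x y. f (x + y) = f x + f y) \<and> (\<forall>x y. f (x * y) = f x * f y)"

text \<open>
  An \<open>h\<close>-torsion-free \<open>\<complex>[[h]]\<close>-algebra (\<open>\<iota>\<close> is the structure map) which is commutative up to
  order \<open>h\<close>; \<open>\<pi>\<close> is the reduction modulo \<open>h\<close>.
\<close>

definition flat_deformation ::
    "(complex fps \<Rightarrow> 'a::ring_1) \<Rightarrow> ('a \<Rightarrow> 'b::comm_ring_1) \<Rightarrow> bool" where
  "flat_deformation \<iota> \<pi> \<longleftrightarrow>
     unital_hom \<iota> \<and> (\<forall>c a. \<iota> c * a = a * \<iota> c) \<and> (\<forall>a. \<iota> fps_X * a = 0 \<longrightarrow> a = 0) \<and>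
     unital_hom \<pi> \<and> surj \<pi> \<and> (\<forall>a. \<pi> a = 0 \<longleftrightarrow> (\<exists>b. a = \<iota> fps_X * b))"

text \<open>The bracket defined by \<open>[a, b] = h {a, b} + O(h\<^sup>2)\<close>.\<close>

definition induced_bracket ::
    "(complex fps \<Rightarrow> 'a::ring_1) \<Rightarrow> ('a \<Rightarrow> 'b::comm_ring_1) \<Rightarrow> 'b \<Rightarrow> 'b \<Rightarrow> 'b" where
  "induced_bracket \<iota> \<pi> x y =
     (THE z. \<exists>a b c. \<pi> a = x \<and> \<pi> b = y \<and> a * b - b * a = \<iota> fps_X * c \<and> z = \<pi> c)"

text \<open>The bracket matrix of the two legs, brackets being taken coefficientwise.\<close>

definition bracket_mat :: "('b \<Rightarrow> 'b \<Rightarrow> 'b) \<Rightarrow> (nat \<Rightarrow> ('b::comm_ring_1, 'n::finite) mat1)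
    \<Rightarrow> ('b biseries, 'n) mat2" where
  "bracket_mat pb g =
     (\<chi> a b. biser (\<lambda>k m. pb (g k $ fst a $ fst b) (g m $ snd a $ snd b)))"

definition matrix_rhs :: "(complex \<Rightarrow> 'b::comm_ring_1)
    \<Rightarrow> (nat \<Rightarrow> ('b, 'n::{finite,linorder}) mat1) \<Rightarrow> ('b biseries, 'n) mat2" where
  "matrix_rhs \<kappa> g =
    (let \<rho> = map_matrix (lift2 \<kappa>) (smat (1 / (lam - mu)) (rmat lam mu));
         \<rho>T = map_matrix (lift2 \<kappa>) (smat (1 / (lam_inv - mu)) (T1 (rmat lam_inv mu)))
     in - (\<rho> ** (G1 g ** G2 g) - (G1 g ** G2 g) ** \<rho>)
        - G1 g ** \<rho>T ** G2 g + G2 g ** \<rho>T ** G1 g)"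

text \<open>The sign \<open>\<epsilon>(i - j)\<close>.\<close>

definition eps :: "'n::linorder \<Rightarrow> 'n \<Rightarrow> complex biseries" where
  "eps i j = (if i < j then - 1 else if i = j then 0 else 1)"

definition entry_rhs :: "(complex \<Rightarrow> 'b::comm_ring_1)
    \<Rightarrow> (nat \<Rightarrow> ('b, 'n::{finite,linorder}) mat1) \<Rightarrow> 'n \<Rightarrow> 'n \<Rightarrow> 'n \<Rightarrow> 'n \<Rightarrow> 'b biseries" where
  "entry_rhs \<kappa> g j i p l =
    (let GL = (\<lambda>a b. ser_lam (\<lambda>k. g k $ a $ b));
         GM = (\<lambda>a b. ser_mu (\<lambda>k. g k $ a $ b));
         u = (lam + mu) / (lam - mu);
         v = (1 + lam * mu) / (1 - lam * mu)
     in lift2 \<kappa> (eps j p - u) * GL p i * GM j l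
      + lift2 \<kappa> (eps i l + u) * GM p i * GL j l
      + lift2 \<kappa> (eps i p - v) * GL j p * GM i l
      + lift2 \<kappa> (eps j l + v) * GL l i * GM p j)"

section \<open>The Poisson algebra \<open>\<DD>\<^sub>n\<close>\<close>

typedef (overloaded) 'n dgen = "{(k :: nat, i :: 'n::{finite,linorder}, j). k \<ge> 1 \<or> i < j}"
  morphisms dgen_index dgen
  by (rule exI[of _ "(1, undefined, undefined)"]) simp

text \<open>Complex polynomials in the generators (the outer exponent is the commutative monoid of monomials).\<close>

type_synonym 'n DD = "('n dgen \<Rightarrow>\<^sub>0 nat) \<Rightarrow>\<^sub>0 complex"

definition DD_const :: "complex \<Rightarrow> 'n::{finite,linorder} DD" where
  "DD_const c = Poly_Mapping.single 0 c"

definition DD_gen :: "nat \<Rightarrow> ('n::{finite,linorder} DD, 'n) mat1" where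
  "DD_gen k = (\<chi> i j.
     if k \<ge> 1 \<or> i < j
     then Poly_Mapping.single (Poly_Mapping.single (dgen (k, i, j)) 1) 1
     else if i = j then 1 else 0)"

text \<open>
  The bracket of \<open>\<DD>\<^sub>n\<close>: a skew-symmetric \<open>\<complex>\<close>-bilinear biderivation with the prescribed values on the
  generators.  These properties determine it.
\<close>

definition DD_bracket :: "('n::{finite,linorder} DD \<Rightarrow> 'n DD \<Rightarrow> 'n DD) \<Rightarrow> bool" where
  "DD_bracket pb \<longleftrightarrow>
     (\<forall>f g. pb f g = - pb g f) \<and>
     (\<forall>f g h. pb (f + g) h = pb f h + pb g h) \<and>
     (\<forall>c f g. pb (DD_const c * f) g = DD_const c * pb f g) \<and>
     (\<forall>f g h. pb (f * g) h = f * pb g h + pb f h * g) \<and>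
     (\<forall>j i p l. biser (\<lambda>k m. pb (DD_gen k $ j $ i) (DD_gen m $ p $ l))
        = entry_rhs DD_const DD_gen j i p l)"

section \<open>The twisted \<open>q\<close>-Yangian\<close>

datatype 'g nc_word = NCWord (letters: "'g list")

instantiation nc_word :: (type) monoid_add
begin
definition "0 = NCWord []"
definition "u + v = NCWord (letters u @ letters v)"
instance by standard (auto simp: zero_nc_word_def plus_nc_word_def)
end

text \<open>The free associative \<open>\<complex>[[h]]\<close>-algebra on \<open>G\<^sup>(\<^sup>k\<^sup>)\<^sub>i\<^sub>j\<close>, \<open>k \<ge> 0\<close>.\<close>

type_synonym 'n free_alg = "(nat \<times> 'n \<times> 'n) nc_word \<Rightarrow>\<^sub>0 complex fps"

definition free_const :: "complex fps \<Rightarrow> 'n free_alg" where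
  "free_const c = Poly_Mapping.single 0 c"

definition free_gen :: "nat \<Rightarrow> ('n::finite free_alg, 'n) mat1" where
  "free_gen k = (\<chi> i j. Poly_Mapping.single (NCWord [(k, i, j)]) 1)"

inductive_set ideal_gen :: "'a::ring_1 set \<Rightarrow> 'a set" for S where
  zero: "0 \<in> ideal_gen S"
| base: "s \<in> S \<Longrightarrow> s \<in> ideal_gen S"
| add: "x \<in> ideal_gen S \<Longrightarrow> y \<in> ideal_gen S \<Longrightarrow> x + y \<in> ideal_gen S"
| left: "x \<in> ideal_gen S \<Longrightarrow> a * x \<in> ideal_gen S"
| right: "x \<in> ideal_gen S \<Longrightarrow> x * a \<in> ideal_gen S"

text \<open>
  The twisted \<open>q\<close>-Yangian is the quotient of the free algebra by the ideal below: all coefficients of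
  the reflection equation, together with the shape of \<open>\<A>\<^sup>(\<^sup>0\<^sup>)\<close>, which is upper triangular with the
  scalar \<open>d\<close> on the diagonal; \<open>d = 1\<close> is the normalisation of Molev--Ragoucy--Sorba.  In the
  theorem \<open>d\<close> is an arbitrary scalar with classical limit \<open>1\<close>.
\<close>

definition yangian_ideal :: "complex fps \<Rightarrow> 'n::{finite,linorder} free_alg set" where
  "yangian_ideal d = ideal_gen
     ({RE_defect free_const free_gen $ a $ b $$ s $$ r | a b s r. True}
      \<union> {free_gen 0 $ i $ j | i j. i > j}
      \<union> {free_gen 0 $ i $ i - free_const d | i. True})"

text \<open>
  For a two-sided ideal \<open>I\<close> of a \<open>\<complex>[[h]]\<close>-algebra \<open>A\<close>: the map \<open>\<pi>\<close> identifies \<open>(A/I)/h(A/I)\<close> with the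
  commutative algebra \<open>B\<close>, and \<open>[a, b] = h {a, b} + O(h\<^sup>2)\<close> holds in \<open>A/I\<close>, the bracket on the right
  being a representative of \<open>{\<pi> a, \<pi> b}\<close>.
\<close>

definition semiclassical_limit :: "(complex fps \<Rightarrow> 'a::ring_1) \<Rightarrow> 'a set
    \<Rightarrow> ('a \<Rightarrow> 'b::comm_ring_1) \<Rightarrow> ('b \<Rightarrow> 'b \<Rightarrow> 'b) \<Rightarrow> bool" where
  "semiclassical_limit \<iota> I \<pi> pb \<longleftrightarrow>
     unital_hom \<pi> \<and> surj \<pi> \<and>
     (\<forall>a. \<pi> a = 0 \<longleftrightarrow> (\<exists>b. a - \<iota> fps_X * b \<in> I)) \<and>
     (\<forall>a b. \<exists>c. a * b - b * a - \<iota> fps_X * c \<in> I \<and> pb (\<pi> a) (\<pi> b) = \<pi> c)"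

end

theory Submission
  imports Defs "HOL-Library.Multiset"
begin

text \<open>
  Put \<open>q = e\<^sup>-\<^sup>h\<close>.  Then \<open>R(\<lambda>,\<mu>) = (\<lambda> - \<mu>) + h r(\<lambda>,\<mu>) + O(h\<^sup>2)\<close>, and multiplied out the reflection
  equation reads \<open>(\<lambda> - \<mu>)(\<lambda>\<^sup>-\<^sup>1 - \<mu>) [G\<^sub>1, G\<^sub>2] + h Q = 0\<close>, where \<open>Q\<close> modulo \<open>h\<close> is minus the same scalar times the matrix
  form of the bracket (lemma \<open>RE_defect_expand\<close>).  The scalar is invertible.  In a flat deformation one
  divides by \<open>h\<close> and obtains the equivalence of the reflection equation to second order with the matrix
  bracket (\<open>reflection_equation_order_h\<close>).  The entrywise form is a direct computation once \<open>r/(\<lambda> - \<mu>)\<close> is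
  written with sign functions (\<open>rho_nth\<close>, \<open>matrix_rhs_entry\<close>).

  For the Poisson algebra \<open>\<DD>\<^sub>n\<close> one needs that the prescribed brackets of generators are consistent.
  They are power series although \<open>1/(\<lambda> - \<mu>)\<close> is not, because that factor multiplies an antisymmetric
  series; they are skew; and they vanish on the entries of \<open>\<A>\<^sup>(\<^sup>0\<^sup>)\<close> that are scalars (\<open>entry_rhs_biser\<close>,
  \<open>entry_coeff_skew\<close>, \<open>entry_coeff_const\<close>).  On a polynomial ring a skew assignment on variables extends
  uniquely to a biderivation (\<open>biderivation_exists\<close>, \<open>derivation_eqI\<close>).

  For the twisted Yangian \<open>A/I\<close>, with \<open>A\<close> the free algebra, the same expansion divided by its leading
  scalar expresses each commutator of generators as \<open>h c\<close> modulo \<open>I\<close>, with \<open>c\<close> lifting the bracket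
  (\<open>generator_commutator\<close>); the Leibniz rule extends this to all of \<open>A\<close> (\<open>yangian_commutator\<close>).  In
  particular \<open>A/(I + h A)\<close> is commutative, so every word is congruent to any rearrangement of it, and
  this identifies \<open>I + h A\<close> with the kernel of the projection to \<open>\<DD>\<^sub>n\<close> (\<open>DD_section_proj\<close>,
  \<open>DD_proj_yangian_ideal\<close>).
\<close>

section \<open>Coefficientwise maps of Laurent series\<close>

lemma unital_homD:
  assumes "unital_hom f"
  shows "f 1 = 1" "f 0 = 0" "f (x + y) = f x + f y" "f (x - y) = f x - f y" "f (- x) = - f x"
    "f (x * y) = f x * f y" "f (sum g A) = (\<Sum>a\<in>A. f (g a))" "f 2 = 2"
proof -
  have add: "f (x + y) = f x + f y" for x y
    using assms by (simp add: unital_hom_def)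
  show 0: "f 0 = 0"
    using add[of 0 0] by simp
  have minus: "f (- x) = - f x" for x
    using add[of x "- x"] 0 by (simp add: eq_neg_iff_add_eq_0 add.commute)
  show one: "f 1 = 1" and "f (x + y) = f x + f y" "f (- x) = - f x" "f (x * y) = f x * f y"
    using assms minus by (simp_all add: unital_hom_def)
  show "f (x - y) = f x - f y"
    using add[of x "- y"] minus by simp
  show "f (sum g A) = (\<Sum>a\<in>A. f (g a))"
    by (induction A rule: infinite_finite_induct) (simp_all add: 0 add)
  show "f 2 = 2"
    using add[of 1 1] one by simp
qed

lemma unital_hom_comp: "unital_hom f \<Longrightarrow> unital_hom g \<Longrightarrow> unital_hom (\<lambda>x. f (g x))"
  by (simp add: unital_hom_def)

definition fls_map :: "('a::zero \<Rightarrow> 'b::zero) \<Rightarrow> 'a fls \<Rightarrow> 'b fls" where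
  "fls_map f F = Abs_fls (\<lambda>n. f (F $$ n))"

lemma fls_map_nth [simp]:
  assumes "f 0 = 0"
  shows "fls_map f F $$ n = f (F $$ n)"
proof -
  \<comment> \<open>\<open>Abs_fls\<close> is meaningful only for functions that vanish far to the left.\<close>
  obtain N where "\<forall>n<N. F $$ n = 0"
    by (rule fls_nth_vanishes_belowE)
  thus ?thesis
    unfolding fls_map_def using assms by (intro nth_Abs_fls_lower_bound) auto
qed

text \<open>
  The library's convolution formula sums between bounds given by the two subdegrees.  A map of
  coefficients can raise subdegrees, so the bounds must be allowed to be loose.
\<close>

lemma fls_times_nth_bounds:
  fixes f g :: "'a::semiring_0 fls"
  assumes "\<forall>i<a. f $$ i = 0" "\<forall>i<b. g $$ i = 0"
  shows "(f * g) $$ n = (\<Sum>i=a..n-b. f $$ i * g $$ (n - i))"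
proof (cases "f = 0 \<or> g = 0")
  case True
  thus ?thesis by (elim disjE) simp_all
next
  case False
  hence "a \<le> fls_subdegree f" "b \<le> fls_subdegree g"
    using assms by (metis fls_subdegree_geI)+
  thus ?thesis
    unfolding fls_times_nth(2) by (intro sum.mono_neutral_left) auto
qed

lemma unital_hom_fls_map:
  assumes f: "unital_hom f"
  shows "unital_hom (fls_map f)"
proof -
  note hom = unital_homD[OF f]
  have "fls_map f (F * G) = fls_map f F * fls_map f G" for F G
  proof (rule fls_eqI)
    fix n
    obtain a where a: "\<forall>i<a. F $$ i = 0" by (rule fls_nth_vanishes_belowE)
    obtain b where b: "\<forall>i<b. G $$ i = 0" by (rule fls_nth_vanishes_belowE)
    have "(fls_map f F * fls_map f G) $$ n = (\<Sum>i=a..n-b. f (F $$ i) * f (G $$ (n - i)))"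
      using a b by (subst fls_times_nth_bounds[where a = a and b = b]) (simp_all add: hom)
    also have "\<dots> = fls_map f (F * G) $$ n"
      using a b by (simp add: fls_times_nth_bounds[where a = a and b = b] hom)
    finally show "fls_map f (F * G) $$ n = (fls_map f F * fls_map f G) $$ n" ..
  qed
  thus ?thesis
    by (auto simp: unital_hom_def hom fls_eq_iff)
qed

abbreviation bimap :: "('a::zero \<Rightarrow> 'b::zero) \<Rightarrow> 'a fls fls \<Rightarrow> 'b fls fls" where
  "bimap f \<equiv> fls_map (fls_map f)"

lemma fls_map_0 [simp]: "f 0 = 0 \<Longrightarrow> fls_map f 0 = 0"
  by (simp add: fls_eq_iff)

lemma unital_hom_bimap: "unital_hom f \<Longrightarrow> unital_hom (bimap f)"
  by (intro unital_hom_fls_map)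

lemma lift2_eq_bimap: "lift2 \<kappa> = bimap \<kappa>"
  by (simp add: fun_eq_iff lift2_def fls_map_def)

lemma biseries_eqI: "(\<And>m k. f $$ m $$ k = g $$ m $$ k) \<Longrightarrow> f = (g :: 'a::zero fls fls)"
  by (simp add: fls_eq_iff)

lemma biser_nth:
  "biser c $$ m $$ k = (if 0 \<le> m \<and> 0 \<le> k then c (nat k) (nat m) else 0)"
  by (simp add: biser_def)

lemma bimap_biser: "f 0 = 0 \<Longrightarrow> bimap f (biser c) = biser (\<lambda>k m. f (c k m))"
  by (intro biseries_eqI) (simp add: biser_nth)

lemma bimap_ser:
  assumes "f 0 = 0"
  shows "bimap f (ser_lam c) = ser_lam (\<lambda>k. f (c k))" "bimap f (ser_mu c) = ser_mu (\<lambda>k. f (c k))"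
  using assms by (simp_all add: ser_lam_def ser_mu_def bimap_biser if_distrib cong: if_cong)

lemma bimap_spectral:
  assumes "f 0 = 0" "f 1 = 1"
  shows "bimap f lam = lam" "bimap f lam_inv = lam_inv" "bimap f mu = mu"
  using assms by (auto simp: lam_def lam_inv_def mu_def intro!: biseries_eqI)

lemma bimap_biconst: "f 0 = 0 \<Longrightarrow> bimap f (biconst a) = biconst (f a)"
  by (auto simp: biconst_def intro!: biseries_eqI)

lemma unital_hom_biconst: "unital_hom (biconst :: 'a::ring_1 \<Rightarrow> _)"
  by (auto simp: unital_hom_def biconst_def fls_eq_iff)

lemma biconst_mult_nth: "(biconst a * F) $$ m $$ k = a * F $$ m $$ k"
  by (simp add: biconst_def)

lemma lam_mult_nth: "(lam * F) $$ m $$ k = F $$ m $$ (k + 1)"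
  by (simp add: lam_def fls_X_inv_times_conv_shift)

lemma mu_mult_nth: "(mu * F) $$ m $$ k = F $$ (m + 1) $$ k"
  by (simp add: mu_def fls_X_inv_times_conv_shift)

lemma lam_inv_mult_nth: "(lam_inv * F) $$ m $$ k = F $$ m $$ (k - 1)"
  by (simp add: lam_inv_def fls_X_times_conv_shift)

lemma lam_mult_lam_inv [simp]: "lam * lam_inv = 1" "lam_inv * lam = 1"
  by (auto intro!: biseries_eqI simp: lam_mult_nth lam_inv_mult_nth) (auto simp: lam_inv_def lam_def)

lemma ser_lam_mult_ser_mu: "ser_lam c * ser_mu d = biser (\<lambda>k m. c k * d m)"
proof -
  have "ser_lam c = fls_const (fps_to_fls (Abs_fps c))"
    by (auto intro!: biseries_eqI simp: ser_lam_def biser_nth)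
  moreover have "ser_mu d = fps_to_fls (Abs_fps (\<lambda>m. fls_const (d m)))"
    by (auto intro!: biseries_eqI simp: ser_mu_def biser_nth)
  ultimately show ?thesis
    by (auto intro!: biseries_eqI simp: biser_nth)
qed

lemma ser_mu_mult_ser_lam: "ser_mu d * ser_lam c = biser (\<lambda>k m. d m * c k)"
proof -
  have "ser_lam c = fls_const (fps_to_fls (Abs_fps c))"
    by (auto intro!: biseries_eqI simp: ser_lam_def biser_nth)
  moreover have "ser_mu d = fps_to_fls (Abs_fps (\<lambda>m. fls_const (d m)))"
    by (auto intro!: biseries_eqI simp: ser_mu_def biser_nth)
  ultimately show ?thesis
    by (auto intro!: biseries_eqI simp: biser_nth)
qed


section \<open>Central scalars and matrices\<close>

definition central :: "'a::ring_1 \<Rightarrow> bool" where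
  "central c \<longleftrightarrow> (\<forall>x. c * x = x * c)"

lemma central_comm [simp]: "central (c :: 'a::comm_ring_1)"
  by (simp add: central_def mult.commute)

lemma central_arith:
  assumes "central a" "central b"
  shows "central (a - b)" "central (a * b)"
proof -
  show "central (a - b)"
    using assms by (simp add: central_def left_diff_distrib right_diff_distrib)
  have "a * b * x = x * (a * b)" for x
  proof -
    have "a * (b * x) = a * (x * b)" using assms(2) by (simp only: central_def)
    also have "\<dots> = (x * a) * b" using assms(1) by (simp only: central_def mult.assoc[symmetric])
    finally show ?thesis by (simp only: mult.assoc)
  qed
  thus "central (a * b)" by (simp add: central_def)
qed

lemma central_spectral: "central lam" "central lam_inv" "central mu"
  by (auto simp: central_def lam_def lam_inv_def mu_def fls_eq_iff fls_X_inv_times_conv_shift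
      fls_X_times_conv_shift)

lemma central_biconst: "central a \<Longrightarrow> central (biconst a)"
  by (simp add: central_def biconst_def fls_eq_iff)

lemma smat_nth [simp]: "smat c M $ a $ b = c * M $ a $ b"
  by (simp add: smat_def)

lemma smat_simps:
  "smat c (A + B) = smat c A + smat c B" "smat c (A - B) = smat c A - smat c B"
  "smat c (- A) = - smat c A" "smat c (smat d A) = smat (c * d) A" "smat 1 A = A" "smat 0 A = 0"
  by (simp_all add: vec_eq_iff algebra_simps)

lemma smat_mult_left: "smat c A ** B = smat c (A ** B)"
  by (simp add: vec_eq_iff matrix_matrix_mult_def sum_distrib_left mult.assoc)

lemma smat_mult_right: "central c \<Longrightarrow> A ** smat c B = smat c (A ** B)"
proof -
  assume c: "central c"
  have "x * (c * y) = c * (x * y)" for x y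
    using c unfolding central_def by (metis mult.assoc)
  thus ?thesis by (simp add: vec_eq_iff matrix_matrix_mult_def sum_distrib_left)
qed

lemma matrix_diff_distrib:
  fixes A :: "'a::ring_1 ^ 'n ^ 'm"
  shows "A ** (B - C) = A ** B - A ** C" "(B' - C') ** A' = B' ** A' - C' ** (A' :: 'a ^ 'n ^ 'm)"
  by (simp_all add: vec_eq_iff matrix_matrix_mult_def algebra_simps sum_subtractf)

lemma map_matrix_hom:
  assumes "unital_hom f"
  shows "map_matrix f (A ** B) = map_matrix f A ** map_matrix f B"
    "map_matrix f (C + D) = map_matrix f C + map_matrix f D"
    "map_matrix f (C - D) = map_matrix f C - map_matrix f D"
    "map_matrix f (- C) = - map_matrix f C"
    "map_matrix f (smat c M) = smat (f c) (map_matrix f M)"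
  by (simp_all add: vec_eq_iff matrix_matrix_mult_def unital_homD[OF assms])

lemma map_matrix_T1: "map_matrix f (T1 M) = T1 (map_matrix f M)"
  by (simp add: vec_eq_iff T1_def)

lemma T1_arith: "T1 (A + B) = T1 A + T1 B" "T1 (smat c A) = smat c (T1 A)"
  "T1 (mat 1) = (mat 1 :: ('a::ring_1, 'n::finite) mat2)"
  by (auto simp: vec_eq_iff T1_def mat_def)

lemma map_matrix_G:
  assumes "unital_hom f"
  shows "map_matrix (bimap f) (G1 G) = G1 (\<lambda>k. map_matrix f (G k))"
    "map_matrix (bimap f) (G2 G) = G2 (\<lambda>k. map_matrix f (G k))"
  by (simp_all add: vec_eq_iff G1_def G2_def tensor_def mat_def bimap_ser 
      unital_homD[OF assms] unital_homD[OF unital_hom_bimap[OF assms]])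

lemma G1_nth: "G1 G $ a $ b = (if snd a = snd b then ser_lam (\<lambda>k. G k $ fst a $ fst b) else 0)"
  by (simp add: G1_def tensor_def mat_def)

lemma G2_nth: "G2 G $ a $ b = (if fst a = fst b then ser_mu (\<lambda>k. G k $ snd a $ snd b) else 0)"
  by (simp add: G2_def tensor_def mat_def)

lemma matrix_mult_nth: "(A ** B) $ a $ b = (\<Sum>c\<in>UNIV. A $ a $ c * B $ c $ b)"
  by (simp add: matrix_matrix_mult_def)

lemma G1_mult_G2: "(G1 G ** G2 G) $ (j, p) $ (i, l)
    = ser_lam (\<lambda>k. G k $ j $ i) * ser_mu (\<lambda>k. G k $ p $ l)"
proof -
  have "(G1 G ** G2 G) $ (j, p) $ (i, l) = (\<Sum>x\<in>UNIV. if x = (i, p) then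
       ser_lam (\<lambda>k. G k $ j $ i) * ser_mu (\<lambda>k. G k $ p $ l) else 0)"
    unfolding matrix_mult_nth by (intro sum.cong) (auto simp: G1_nth G2_nth)
  thus ?thesis by simp
qed

lemma G2_mult_G1: "(G2 G ** G1 G) $ (j, p) $ (i, l)
    = ser_mu (\<lambda>k. G k $ p $ l) * ser_lam (\<lambda>k. G k $ j $ i)"
proof -
  have "(G2 G ** G1 G) $ (j, p) $ (i, l) = (\<Sum>x\<in>UNIV. if x = (j, l) then
       ser_mu (\<lambda>k. G k $ p $ l) * ser_lam (\<lambda>k. G k $ j $ i) else 0)"
    unfolding matrix_mult_nth by (intro sum.cong) (auto simp: G1_nth G2_nth)
  thus ?thesis by simp
qed


section \<open>Expansion of the reflection equation in \<open>h\<close>\<close>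

lemma sum_matrix_units_nth:
  fixes S :: "'n::finite \<Rightarrow> 'n set"
  shows "(\<Sum>i\<in>UNIV. \<Sum>j\<in>S i. E i j \<otimes> E j i :: ('a::ring_1, 'n) mat2) $ (a, b) $ (c, d)
    = (if a = d \<and> b = c \<and> b \<in> S a then 1 else 0)"
proof -
  have unit: "(E i j \<otimes> E j i :: ('a, 'n) mat2) $ (a, b) $ (c, d)
      = (if j = b then if i = a then if a = d \<and> b = c then 1 else 0 else 0 else 0)" for i j
    by (auto simp: tensor_def E_def)
  have "(\<Sum>i\<in>UNIV. \<Sum>j\<in>S i. E i j \<otimes> E j i :: ('a, 'n) mat2) $ (a, b) $ (c, d)
    = (\<Sum>i\<in>UNIV. if i = a then if a = d \<and> b = c \<and> b \<in> S a then 1 else 0 else 0)"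
    unfolding sum_component unit by (intro sum.cong refl) (auto simp: sum.delta)
  thus ?thesis by simp
qed

lemma sum_diagonal_units_nth:
  fixes S :: "'n::finite \<Rightarrow> 'n set"
  shows "(\<Sum>i\<in>UNIV. \<Sum>j\<in>S i. E i i \<otimes> E j j :: ('a::ring_1, 'n) mat2) $ (a, b) $ (c, d)
    = (if a = c \<and> b = d \<and> b \<in> S a then 1 else 0)"
proof -
  have unit: "(E i i \<otimes> E j j :: ('a, 'n) mat2) $ (a, b) $ (c, d)
      = (if j = b then if i = a then if a = c \<and> b = d then 1 else 0 else 0 else 0)" for i j
    by (auto simp: tensor_def E_def)
  have "(\<Sum>i\<in>UNIV. \<Sum>j\<in>S i. E i i \<otimes> E j j :: ('a, 'n) mat2) $ (a, b) $ (c, d)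
    = (\<Sum>i\<in>UNIV. if i = a then if a = c \<and> b = d \<and> b \<in> S a then 1 else 0 else 0)"
    unfolding sum_component unit by (intro sum.cong refl) (auto simp: sum.delta)
  thus ?thesis by simp
qed

lemma sum_diagonal_nth:
  "(\<Sum>i\<in>UNIV. E i i \<otimes> E i i :: ('a::ring_1, 'n::finite) mat2) $ (a, b) $ (c, d)
    = (if a = b \<and> a = c \<and> a = d then 1 else 0)"
proof -
  have "(\<Sum>i\<in>UNIV. \<Sum>j\<in>{i}. E i j \<otimes> E j i :: ('a, 'n) mat2) $ (a, b) $ (c, d)
      = (if a = b \<and> a = c \<and> a = d then 1 else 0)"
    unfolding sum_matrix_units_nth by auto
  thus ?thesis by simp
qed

lemma rmat_nth:
  "rmat l m $ (a, b) $ (c, d) =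
    (if a = d \<and> b = c then (if a = b then l + m else if a < b then 2 * l else 2 * m) else 0)"
proof (cases a b rule: linorder_cases)
  case less
  hence "\<not> b < a" "a \<noteq> b" by auto
  with less show ?thesis
    unfolding rmat_def vector_add_component smat_nth sum_matrix_units_nth sum_diagonal_nth
      mem_Collect_eq
    by (simp only: if_True if_False simp_thms; simp)
next
  case equal
  thus ?thesis
    unfolding rmat_def vector_add_component smat_nth sum_matrix_units_nth sum_diagonal_nth
      mem_Collect_eq
    by (simp only: if_True if_False simp_thms less_irrefl; auto)
next
  case greater
  hence "\<not> a < b" "a \<noteq> b" by auto
  with greater show ?thesis
    unfolding rmat_def vector_add_component smat_nth sum_matrix_units_nth sum_diagonal_nth
      mem_Collect_eq
    by (simp only: if_True if_False simp_thms; simp)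
qed

lemma Rmat_nth:
  fixes l m :: "'a::ring_1"
  shows "Rmat q q' l m $ (a, b) $ (c, d) =
    (if a = c \<and> b = d then (if a = b then q' * l - q * m else l - m)
     else if a = d \<and> b = c then (if a < b then (q' - q) * l else (q' - q) * m) else 0)"
proof -
  have *: "x * (if a = c \<and> b = d \<and> b \<in> {j. a \<noteq> j} then 1 else 0)
      + y * (if a = b \<and> a = c \<and> a = d then 1 else 0)
      + z * (if a = d \<and> b = c \<and> b \<in> {j. a < j} then 1 else 0)
      + w * (if a = d \<and> b = c \<and> b \<in> {j. b < a} then 1 else 0)
    = (if a = c \<and> b = d then (if a = b then y else x)
       else if a = d \<and> b = c then (if a < b then z else w) else 0)" for x y z w :: 'a
  proof (cases "a = c \<and> b = d")
    case True
    thus ?thesis by (cases "a = b") auto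
  next
    case False
    show ?thesis
    proof (cases "a = d \<and> b = c")
      case True
      hence "a \<noteq> b" using False by auto
      thus ?thesis
        using True False by (cases a b rule: linorder_cases) auto
    next
      case 2: False
      from False 2 have "\<not> (a = c \<and> b = d \<and> P)" "\<not> (a = d \<and> b = c \<and> P)" "\<not> (a = b \<and> a = c \<and> a = d)" for P
        by auto
      thus ?thesis
        using False 2 by (simp only: if_False) simp
    qed
  qed
  show ?thesis
    unfolding Rmat_def vector_add_component smat_nth sum_matrix_units_nth sum_diagonal_units_nth
      sum_diagonal_nth using *[of "l - m" "q' * l - q * m" "(q' - q) * l" "(q' - q) * m"]
    by (simp only: mem_Collect_eq)
qed

text \<open>
  The remainder \<open>Z\<close> affects the reflection equation only at order \<open>h\<^sup>2\<close>, so its existence is enough.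
\<close>

lemma Rmat_expand:
  fixes l m :: "'a::ring_1"
  assumes q: "q = 1 - h + h * h * s" and q': "q' = 1 + h + h * h * s'"
  obtains Z :: "('a, 'n::{finite,linorder}) mat2" where "Rmat q q' l m = smat (l - m) (mat 1) + smat h (rmat l m + smat h Z)"
proof
  define Z :: "('a, 'n) mat2" where
    "Z = (\<chi> a b. if fst a = snd b \<and> snd a = fst b then
       (if fst a = snd a then s' * l - s * m else if fst a < snd a then (s' - s) * l else (s' - s) * m)
       else 0)"
  have Z: "Z $ (a, b) $ (c, d) = (if a = d \<and> b = c then
       (if a = b then s' * l - s * m else if a < b then (s' - s) * l else (s' - s) * m) else 0)"
    for a b c d by (simp add: Z_def)
  have "Rmat q q' l m $ (a, b) $ (c, d)
      = (smat (l - m) (mat 1) + smat h (rmat l m + smat h Z)) $ (a, b) $ (c, d)" for a b c d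
  proof -
    consider "a = b" "a = c" "a = d" | "a \<noteq> b" "a = c" "b = d" | "a \<noteq> b" "a = d" "b = c"
      | "\<not> (a = c \<and> b = d)" "\<not> (a = d \<and> b = c)"
      by blast
    thus ?thesis
      unfolding vector_add_component smat_nth Rmat_nth rmat_nth Z mat_def vec_lambda_beta prod.inject
      by cases (simp_all only: if_True if_False simp_thms, simp_all add: q q' mult_2 algebra_simps)
  qed
  thus "Rmat q q' l m = smat (l - m) (mat 1) + smat h (rmat l m + smat h Z)"
    unfolding vec_eq_iff split_paired_All by simp
qed

lemma fps_exp_expand:
  "fps_exp (c :: complex) = 1 + fps_const c * fps_X + fps_X * fps_X * fps_shift 2 (fps_exp c)"
proof (rule fps_ext)
  fix n :: nat
  have X: "fps_X * fps_X * f = fps_X ^ 2 * f" for f :: "complex fps"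
    by (simp add: power2_eq_square)
  consider "n = 0" | "n = 1" | k where "n = k + 2"
    by (metis One_nat_def Suc_1 add_2_eq_Suc' not0_implies_Suc)
  thus "fps_nth (fps_exp c) n = fps_nth (1 + fps_const c * fps_X + fps_X * fps_X * fps_shift 2 (fps_exp c)) n"
    by cases (auto simp: X fps_X_power_mult_nth)
qed

lemma R_expand:
  fixes l m :: "'a::ring_1 biseries"
  assumes \<iota>: "unital_hom \<iota>"
  defines "H \<equiv> biconst (\<iota> fps_X)"
  obtains Z :: "('a biseries, 'n::{finite,linorder}) mat2" where "R \<iota> l m = smat (l - m) (mat 1) + smat H (rmat l m + smat H Z)"
proof -
  define u where "u = (\<lambda>c. biconst (\<iota> c) :: 'a biseries)"
  have u: "unital_hom u"
    unfolding u_def using unital_hom_comp[OF unital_hom_biconst \<iota>] by simp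
  have "fps_exp 1 = (1 :: complex fps) + fps_X + fps_X * fps_X * fps_shift 2 (fps_exp 1)"
    using fps_exp_expand[of 1] by simp
  hence 1: "u (fps_exp 1) = 1 + H + H * H * u (fps_shift 2 (fps_exp 1))"
    unfolding H_def u_def[symmetric] by (metis (no_types) u_def unital_homD(1,3,6)[OF u])
  have "fps_exp (-1) = (1 :: complex fps) - fps_X + fps_X * fps_X * fps_shift 2 (fps_exp (-1))"
    using fps_exp_expand[of "-1"] by (simp add: fps_const_neg[symmetric] del: fps_const_neg)
  hence 2: "u (fps_exp (-1)) = 1 - H + H * H * u (fps_shift 2 (fps_exp (-1)))"
    unfolding H_def u_def[symmetric] by (metis (no_types) u_def unital_homD(1,3,4,6)[OF u])
  show thesis
    using that Rmat_expand[OF 2 1, of l m] unfolding R_def u_def by metis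
qed

theorem R_second_order:
  "O_h id 2 ((R id l m :: (complex fps biseries, 'n::{finite,linorder}) mat2)
     - (smat (l - m) (mat 1 \<otimes> mat 1) + smat (biconst fps_X) (rmat l m)))"
proof -
  have "unital_hom (id :: complex fps \<Rightarrow> _)"
    by (simp add: unital_hom_def)
  then obtain Z :: "(complex fps biseries, 'n) mat2" where
    "R id l m = smat (l - m) (mat 1) + smat (biconst (id fps_X)) (rmat l m + smat (biconst (id fps_X)) Z)"
    by (rule R_expand)
  moreover have "mat 1 \<otimes> mat 1 = (mat 1 :: (complex fps biseries, 'n) mat2)"
    by (auto simp: vec_eq_iff tensor_def mat_def prod_eq_iff)
  ultimately show ?thesis
    by (auto simp: O_h_def biconst_mult_nth smat_simps power2_eq_square mult.assoc)
qed

lemma complex_spectral_differences: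
  "lam - mu \<noteq> (0 :: complex biseries)" "lam_inv - mu \<noteq> (0 :: complex biseries)"
  "1 - lam * mu \<noteq> (0 :: complex biseries)"
proof -
  have "(lam - mu :: complex biseries) $$ (-1) $$ 0 \<noteq> 0" "(lam_inv - mu :: complex biseries) $$ (-1) $$ 0 \<noteq> 0"
    "(1 - lam * mu :: complex biseries) $$ 0 $$ 0 \<noteq> 0"
    by (simp_all add: lam_mult_nth) (simp_all add: lam_def lam_inv_def mu_def)
  thus "lam - mu \<noteq> (0 :: complex biseries)" "lam_inv - mu \<noteq> (0 :: complex biseries)"
    "1 - lam * mu \<noteq> (0 :: complex biseries)"
    by (metis fls_zero_nth)+
qed

lemma lift2_hom: "unital_hom \<kappa> \<Longrightarrow> unital_hom (lift2 \<kappa>)"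
  by (simp add: lift2_eq_bimap unital_hom_bimap)

lemma lift2_spectral:
  assumes "unital_hom \<kappa>"
  shows "lift2 \<kappa> lam = lam" "lift2 \<kappa> lam_inv = lam_inv" "lift2 \<kappa> mu = mu"
  by (simp_all add: lift2_eq_bimap bimap_spectral unital_homD[OF assms])

lemma map_matrix_rmat:
  assumes "unital_hom f"
  shows "map_matrix f (rmat l m) = rmat (f l) (f m)"
  unfolding vec_eq_iff split_paired_All nth_map_matrix rmat_nth
  by (auto simp: unital_homD[OF assms])

abbreviation denom :: "'a::ring_1 biseries" where
  "denom \<equiv> (lam - mu) * (lam_inv - mu)"

text \<open>
  The leading coefficient of the reflection equation is \<open>(\<lambda> - \<mu>)(\<lambda>\<^sup>-\<^sup>1 - \<mu>)\<close>.  It is invertible because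
  it is a nonzero element of the field of complex biseries, carried over by a ring homomorphism.
\<close>

lemma denom_cancel:
  assumes \<kappa>: "unital_hom \<kappa>"
  shows "denom * lift2 \<kappa> (1 / denom) = 1" "lift2 \<kappa> (1 / denom) * denom = 1"
proof -
  note hom = unital_homD[OF lift2_hom[OF \<kappa>]]
  have d: "denom = lift2 \<kappa> denom"
    by (simp only: hom lift2_spectral[OF \<kappa>])
  have nz: "denom \<noteq> (0 :: complex biseries)"
    using complex_spectral_differences by simp
  have "lift2 \<kappa> denom * lift2 \<kappa> (1 / denom) = lift2 \<kappa> (denom * (1 / denom))"
    by (simp only: hom)
  also have "denom * (1 / denom) = (1 :: complex biseries)"
    using nz by (metis nonzero_mult_div_cancel_left times_divide_eq_right mult_1_right)
  finally show "denom * lift2 \<kappa> (1 / denom) = 1"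
    by (simp only: d hom)
  have "lift2 \<kappa> (1 / denom) * lift2 \<kappa> denom = lift2 \<kappa> (1 / denom * denom)"
    by (simp only: hom)
  also have "1 / denom * denom = (1 :: complex biseries)"
    using nz by (metis nonzero_eq_divide_eq)
  finally show "lift2 \<kappa> (1 / denom) * denom = 1"
    by (simp only: d hom)
qed

lemma denom_matrix_rhs:
  fixes g :: "nat \<Rightarrow> ('b::comm_ring_1, 'n::{finite,linorder}) mat1"
  assumes \<kappa>: "unital_hom \<kappa>"
  shows "smat denom (matrix_rhs \<kappa> g) =
    - smat (lam_inv - mu) (rmat lam mu ** (G1 g ** G2 g) - (G1 g ** G2 g) ** rmat lam mu)
    - smat (lam - mu) (G1 g ** T1 (rmat lam_inv mu) ** G2 g)
    + smat (lam - mu) (G2 g ** T1 (rmat lam_inv mu) ** G1 g)"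
proof -
  note hom = unital_homD[OF lift2_hom[OF \<kappa>]]
  define u where "u = lift2 \<kappa> (1 / (lam - mu))"
  define v where "v = lift2 \<kappa> (1 / (lam_inv - mu))"
  have cancel: "d * (1 / d) = 1" if "d \<noteq> 0" for d :: "complex biseries"
    using that by simp
  have u: "(lam - mu) * u = 1"
  proof -
    have "(lam - mu) * u = lift2 \<kappa> ((lam - mu) * (1 / (lam - mu)))"
      unfolding u_def by (simp only: hom lift2_spectral[OF \<kappa>])
    thus ?thesis by (simp only: cancel[OF complex_spectral_differences(1)] hom)
  qed
  have v: "(lam_inv - mu) * v = 1"
  proof -
    have "(lam_inv - mu) * v = lift2 \<kappa> ((lam_inv - mu) * (1 / (lam_inv - mu)))"
      unfolding v_def by (simp only: hom lift2_spectral[OF \<kappa>])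
    thus ?thesis by (simp only: cancel[OF complex_spectral_differences(2)] hom)
  qed
  have du: "denom * u = lam_inv - mu"
  proof -
    have "denom * u = (lam - mu) * u * (lam_inv - mu)" by (simp only: mult_ac)
    thus ?thesis by (simp only: u mult_1_left)
  qed
  have dv: "denom * v = lam - mu"
  proof -
    have "denom * v = (lam_inv - mu) * v * (lam - mu)" by (simp only: mult_ac)
    thus ?thesis by (simp only: v mult_1_left)
  qed
  have \<rho>: "map_matrix (lift2 \<kappa>) (smat (1 / (lam - mu)) (rmat lam mu)) = smat u (rmat lam mu)"
    by (simp add: map_matrix_hom[OF lift2_hom[OF \<kappa>]] map_matrix_rmat[OF lift2_hom[OF \<kappa>]]
        lift2_spectral[OF \<kappa>] u_def)
  have \<rho>T: "map_matrix (lift2 \<kappa>) (smat (1 / (lam_inv - mu)) (T1 (rmat lam_inv mu)))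
      = smat v (T1 (rmat lam_inv mu))"
    by (simp add: map_matrix_hom[OF lift2_hom[OF \<kappa>]] map_matrix_rmat[OF lift2_hom[OF \<kappa>]]
        lift2_spectral[OF \<kappa>] v_def map_matrix_T1)
  show ?thesis
    unfolding matrix_rhs_def Let_def \<rho> \<rho>T
    by (simp only: smat_mult_left smat_mult_right[OF central_comm] smat_simps du dv)
qed

lemma G1_G2_commute:
  fixes g :: "nat \<Rightarrow> ('b::comm_ring_1, 'n::finite) mat1"
  shows "G2 g ** G1 g = G1 g ** G2 g"
  unfolding vec_eq_iff split_paired_All by (simp add: G1_mult_G2 G2_mult_G1 mult.commute)

lemma matrix_add_mult_distrib: "(A + B) ** C = A ** C + B ** (C :: 'a::semiring_1 ^ 'n ^ 'm)"
  by (simp add: vec_eq_iff matrix_matrix_mult_def distrib_right sum.distrib)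

text \<open>
  Writing \<open>R(\<lambda>,\<mu>) = (\<lambda> - \<mu>) + h X\<close> and \<open>R(\<lambda>\<^sup>-\<^sup>1,\<mu>)\<^sup>T = (\<lambda>\<^sup>-\<^sup>1 - \<mu>) + h Y\<close> and multiplying out,
  the only terms without a factor \<open>h\<close> are the two products of the scalars, which give the commutator
  of the two legs.  Everything else is \<open>h Q\<close>, and \<open>Q\<close> modulo \<open>h\<close> is computed with commuting entries,
  where \<open>X\<close> and \<open>Y\<close> become \<open>r\<close> and its transpose.  The expansion serves both for flat
  deformations and for the free algebra.
\<close>

lemma RE_defect_expand:
  fixes G :: "nat \<Rightarrow> ('a::ring_1, 'n::{finite,linorder}) mat1" and \<pi> :: "'a \<Rightarrow> 'b::comm_ring_1"
  assumes \<iota>: "unital_hom \<iota>" and \<iota>_central: "\<forall>c a. \<iota> c * a = a * \<iota> c"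
    and \<pi>: "unital_hom \<pi>" and \<pi>h: "\<pi> (\<iota> fps_X) = 0" and \<kappa>: "unital_hom \<kappa>"
  obtains Q where
    "RE_defect \<iota> G = smat denom (G1 G ** G2 G - G2 G ** G1 G) + smat (biconst (\<iota> fps_X)) Q"
    "map_matrix (bimap \<pi>) Q = - smat denom (matrix_rhs \<kappa> (\<lambda>k. map_matrix \<pi> (G k)))"
proof -
  define H :: "'a biseries" where "H = biconst (\<iota> fps_X)"
  obtain Z1 :: "('a biseries, 'n) mat2" where Z1: "R \<iota> lam mu = smat (lam - mu) (mat 1) + smat H (rmat lam mu + smat H Z1)"
    unfolding H_def by (rule R_expand[OF \<iota>])
  obtain Z2 :: "('a biseries, 'n) mat2" where Z2: "R \<iota> lam_inv mu = smat (lam_inv - mu) (mat 1) + smat H (rmat lam_inv mu + smat H Z2)"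
    unfolding H_def by (rule R_expand[OF \<iota>])
  define X where "X = rmat lam mu + smat H Z1"
  define Y where "Y = T1 (rmat lam_inv mu) + smat H (T1 Z2)"
  have RX: "R \<iota> lam mu = smat (lam - mu) (mat 1) + smat H X"
    by (simp add: Z1 X_def)
  have RY: "T1 (R \<iota> lam_inv mu) = smat (lam_inv - mu) (mat 1) + smat H Y"
    by (simp add: Z2 Y_def T1_arith)
  define Q where "Q = smat (lam_inv - mu) (X ** (G1 G ** G2 G) - (G2 G ** G1 G) ** X)
    + smat (lam - mu) (G1 G ** Y ** G2 G) - smat (lam - mu) (G2 G ** Y ** G1 G)
    + smat H (X ** G1 G ** Y ** G2 G - G2 G ** Y ** G1 G ** X)"
  have central: "central (lam - mu :: 'a biseries)" "central (lam_inv - mu :: 'a biseries)" "central H"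
    unfolding H_def
    using \<iota>_central central_def[of "\<iota> fps_X"] by (blast intro: central_arith central_spectral central_biconst)+
  have RE: "RE_defect \<iota> G = smat denom (G1 G ** G2 G - G2 G ** G1 G) + smat H Q"
  proof -
    define d1 d2 :: "'a biseries" where "d1 = lam - mu" and "d2 = lam_inv - mu"
    note c = central[folded d1_def d2_def]
    have comm: "d2 * d1 = d1 * d2" "d1 * H = H * d1" "d2 * H = H * d2"
      using c unfolding central_def by blast+
    show ?thesis
      unfolding RE_defect_def RX RY Q_def d1_def[symmetric] d2_def[symmetric]
      by (simp add: matrix_add_ldistrib matrix_add_mult_distrib matrix_diff_distrib smat_mult_left
          smat_mult_right[OF c(1)] smat_mult_right[OF c(2)] smat_mult_right[OF c(3)]
          smat_simps(1-4) matrix_mul_assoc comm)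
  qed
  have "map_matrix (bimap \<pi>) Q = - smat denom (matrix_rhs \<kappa> (\<lambda>k. map_matrix \<pi> (G k)))"
  proof -
    note B = unital_hom_bimap[OF \<pi>]
    have spec: "bimap \<pi> lam = lam" "bimap \<pi> lam_inv = lam_inv" "bimap \<pi> mu = mu" "bimap \<pi> H = 0"
      using bimap_spectral[of \<pi>] unital_homD[OF \<pi>] \<pi>h
      by (simp_all add: H_def bimap_biconst) (simp add: biconst_def)
    have "map_matrix (bimap \<pi>) X = rmat lam mu" "map_matrix (bimap \<pi>) Y = T1 (rmat lam_inv mu)"
      by (simp_all add: X_def Y_def map_matrix_hom[OF B] map_matrix_rmat[OF B] map_matrix_T1 spec smat_simps)
    thus ?thesis
      unfolding denom_matrix_rhs[OF \<kappa>] Q_def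
      by (simp add: map_matrix_hom[OF B] map_matrix_G[OF \<pi>] G1_G2_commute unital_homD(4)[OF B] spec smat_simps)
  qed
  with RE show thesis
    using that by (simp only: H_def)
qed

section \<open>The bracket of a flat deformation\<close>

text \<open>
  The bracket does not depend on the lifts: replacing \<open>a\<close> by \<open>a + h x\<close> changes the commutator by
  \<open>h [x, b]\<close>, and \<open>[x, b]\<close> is itself divisible by \<open>h\<close>.
\<close>

lemma induced_bracket_eq:
  assumes flat: "flat_deformation \<iota> \<pi>" and c: "a * b - b * a = \<iota> fps_X * c"
  shows "induced_bracket \<iota> \<pi> (\<pi> a) (\<pi> b) = \<pi> c"
  unfolding induced_bracket_def
proof (rule the_equality)
  show "\<exists>a' b' c'. \<pi> a' = \<pi> a \<and> \<pi> b' = \<pi> b \<and> a' * b' - b' * a' = \<iota> fps_X * c' \<and> \<pi> c = \<pi> c'"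
    using c by blast
next
  fix z assume "\<exists>a' b' c'. \<pi> a' = \<pi> a \<and> \<pi> b' = \<pi> b \<and> a' * b' - b' * a' = \<iota> fps_X * c' \<and> z = \<pi> c'"
  then obtain a' b' c' where 1: "\<pi> a' = \<pi> a" "\<pi> b' = \<pi> b" "a' * b' - b' * a' = \<iota> fps_X * c'" "z = \<pi> c'"
    by blast
  have \<pi>: "unital_hom \<pi>" and cent: "\<And>x. \<iota> fps_X * x = x * \<iota> fps_X"
    and tf: "\<And>x. \<iota> fps_X * x = 0 \<Longrightarrow> x = 0" and ker: "\<And>x. \<pi> x = 0 \<longleftrightarrow> (\<exists>y. x = \<iota> fps_X * y)"
    using flat by (auto simp: flat_deformation_def)
  note hom = unital_homD[OF \<pi>]
  define h where "h = \<iota> fps_X"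
  have "\<pi> (a' - a) = 0" "\<pi> (b' - b) = 0"
    by (simp_all add: hom 1)
  then obtain x y where xy: "a' - a = h * x" "b' - b = h * y"
    unfolding ker h_def by blast
  have a': "a' = a + h * x" and b': "b' = b + h * y"
    using xy by (simp_all add: algebra_simps)
  have hc: "u * (h * v) = h * (u * v)" for u v
    using cent by (metis h_def mult.assoc)
  have "h * (c' - c - (a * y - y * a) - (x * b - b * x) - h * (x * y - y * x)) = 0"
    using 1(3) c unfolding a' b' h_def[symmetric]
    by (simp add: algebra_simps hc[of a y] hc[of b x] hc[of x y] hc[of y x])
  hence "c' - c - (a * y - y * a) - (x * b - b * x) - h * (x * y - y * x) = 0"
    unfolding h_def by (rule tf)
  hence "\<pi> (c' - c - (a * y - y * a) - (x * b - b * x) - h * (x * y - y * x)) = 0"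
    by (simp add: hom)
  moreover have "\<pi> h = 0"
    unfolding ker h_def by (rule exI[of _ 1]) simp
  ultimately show "z = \<pi> c"
    by (simp add: hom 1 mult.commute)
qed

text \<open>
  With \<open>[G\<^sub>1, G\<^sub>2] = h K\<close> the defect is \<open>h (denom K + Q)\<close>.  As \<open>h\<close> is not a zero divisor, the defect
  vanishes to second order iff \<open>denom K + Q\<close> vanishes modulo \<open>h\<close>, and the invertible factor can
  then be divided out.
\<close>

theorem reflection_equation_order_h:
  fixes G :: "nat \<Rightarrow> ('a::ring_1, 'n::{finite,linorder}) mat1" and \<pi> :: "'a \<Rightarrow> 'b::comm_ring_1"
  assumes flat: "flat_deformation \<iota> \<pi>"
  shows "O_h \<iota> 2 (RE_defect \<iota> G) \<longleftrightarrow>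
    bracket_mat (induced_bracket \<iota> \<pi>) (\<lambda>k. map_matrix \<pi> (G k))
      = matrix_rhs (\<lambda>c. \<pi> (\<iota> (fps_const c))) (\<lambda>k. map_matrix \<pi> (G k))"
proof -
  define \<kappa> where "\<kappa> = (\<lambda>c. \<pi> (\<iota> (fps_const c)))"
  define g where "g = (\<lambda>k. map_matrix \<pi> (G k))"
  define h where "h = \<iota> fps_X"
  have \<iota>: "unital_hom \<iota>" and cent: "\<forall>c x. \<iota> c * x = x * \<iota> c" and \<pi>: "unital_hom \<pi>"
    and tf: "\<And>x. h * x = 0 \<Longrightarrow> x = 0" and ker: "\<And>x. \<pi> x = 0 \<longleftrightarrow> (\<exists>y. x = h * y)"
    using flat by (auto simp: flat_deformation_def h_def)
  note hom = unital_homD[OF \<pi>]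
  have "unital_hom (fps_const :: complex \<Rightarrow> _)"
    by (simp add: unital_hom_def fps_const_add fps_const_mult)
  hence \<kappa>: "unital_hom \<kappa>"
    unfolding \<kappa>_def using unital_hom_comp[OF \<pi> unital_hom_comp[OF \<iota>]] by blast
  have \<pi>h: "\<pi> h = 0"
    unfolding ker by (rule exI[of _ 1]) simp
  obtain Q where Q: "RE_defect \<iota> G = smat denom (G1 G ** G2 G - G2 G ** G1 G) + smat (biconst h) Q"
    "map_matrix (bimap \<pi>) Q = - smat denom (matrix_rhs \<kappa> g)"
    unfolding g_def h_def by (rule RE_defect_expand[OF \<iota> cent \<pi> \<pi>h[unfolded h_def] \<kappa>])
  have "\<exists>c. a * b - b * a = h * c" for a b
    using ker[of "a * b - b * a"] by (simp add: hom mult.commute)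
  then obtain C where C: "\<And>a b. a * b - b * a = h * C a b"
    by metis
  have bracket: "induced_bracket \<iota> \<pi> (\<pi> a) (\<pi> b) = \<pi> (C a b)" for a b
    by (rule induced_bracket_eq[OF flat]) (simp add: C flip: h_def)
  define K :: "('a biseries, 'n) mat2" where
    "K = (\<chi> a b. biser (\<lambda>k m. C (G k $ fst a $ fst b) (G m $ snd a $ snd b)))"
  have "G1 G ** G2 G - G2 G ** G1 G = smat (biconst h) K"
    unfolding vec_eq_iff split_paired_All
    by (auto simp: G1_mult_G2 G2_mult_G1 ser_lam_mult_ser_mu
        ser_mu_mult_ser_lam K_def biconst_mult_nth biser_nth C intro!: biseries_eqI)
  moreover have hc: "central (biconst h)"
    using cent by (intro central_biconst) (simp add: h_def central_def)
  ultimately have RE: "RE_defect \<iota> G = smat (biconst h) (smat denom K + Q)"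
    unfolding Q(1) by (simp add: smat_simps) (simp add: central_def)
  have K: "map_matrix (bimap \<pi>) K = bracket_mat (induced_bracket \<iota> \<pi>) g"
    by (auto simp: vec_eq_iff K_def bimap_biser hom bracket_mat_def g_def bracket)
  have "O_h \<iota> 2 (RE_defect \<iota> G) \<longleftrightarrow> (\<forall>a b s r. \<pi> ((smat denom K + Q) $ a $ b $$ s $$ r) = 0)"
  proof -
    have "(\<exists>c. h * x = h ^ 2 * c) \<longleftrightarrow> \<pi> x = 0" for x
    proof
      assume "\<exists>c. h * x = h ^ 2 * c"
      then obtain c where "h * x = h ^ 2 * c" by blast
      hence "h * (x - h * c) = 0" by (simp add: right_diff_distrib power2_eq_square mult.assoc)
      hence "x - h * c = 0" by (rule tf)
      thus "\<pi> x = 0" unfolding ker by (metis eq_iff_diff_eq_0)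
    next
      assume "\<pi> x = 0"
      thus "\<exists>c. h * x = h ^ 2 * c" unfolding ker by (auto simp: power2_eq_square mult.assoc)
    qed
    thus ?thesis
      unfolding O_h_def RE by (simp add: biconst_mult_nth flip: h_def)
  qed
  also have "\<dots> \<longleftrightarrow> map_matrix (bimap \<pi>) (smat denom K + Q) = 0"
    by (simp add: vec_eq_iff fls_eq_iff hom)
  also have "map_matrix (bimap \<pi>) (smat denom K + Q)
      = smat denom (bracket_mat (induced_bracket \<iota> \<pi>) g - matrix_rhs \<kappa> g)"
    using bimap_spectral[of \<pi>]
    by (simp add: map_matrix_hom[OF unital_hom_bimap[OF \<pi>]] K Q(2) unital_homD(4,6)[OF unital_hom_bimap[OF \<pi>]] hom smat_simps)
  also have "\<dots> = 0 \<longleftrightarrow> bracket_mat (induced_bracket \<iota> \<pi>) g - matrix_rhs \<kappa> g = 0"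
  proof
    assume "smat denom (bracket_mat (induced_bracket \<iota> \<pi>) g - matrix_rhs \<kappa> g) = 0"
    hence "smat (lift2 \<kappa> (1 / denom)) (smat denom (bracket_mat (induced_bracket \<iota> \<pi>) g - matrix_rhs \<kappa> g)) = 0"
      by (simp add: vec_eq_iff)
    thus "bracket_mat (induced_bracket \<iota> \<pi>) g - matrix_rhs \<kappa> g = 0"
      by (simp only: smat_simps(4,5) denom_cancel[OF \<kappa>])
  qed (simp add: vec_eq_iff)
  finally show ?thesis
    by (simp add: \<kappa>_def g_def)
qed

section \<open>The bracket entrywise\<close>

text \<open>
  The three sums in \<open>r\<close> combine: since \<open>2\<lambda> = (\<lambda> + \<mu>) + (\<lambda> - \<mu>)\<close> and \<open>2\<mu> = (\<lambda> + \<mu>) - (\<lambda> - \<mu>)\<close>, dividing by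
  \<open>\<lambda> - \<mu>\<close> gives \<open>\<Sum>\<^sub>a\<^sub>b ((\<lambda> + \<mu>)/(\<lambda> - \<mu>) - \<epsilon>(a - b)) E\<^sub>a\<^sub>b \<otimes> E\<^sub>b\<^sub>a\<close>.  This is where the sign functions of the
  entrywise bracket come from.
\<close>

lemma rho_nth:
  fixes l m :: "complex biseries"
  assumes "l - m \<noteq> 0"
  shows "smat (1 / (l - m)) (rmat l m) $ (a, b) $ (c, d)
    = (if a = d \<and> b = c then (l + m) / (l - m) - eps a b else 0)"
proof -
  have "l + m + (l - m) = 2 * l" "l + m - (l - m) = 2 * m"
    by (simp_all add: algebra_simps)
  hence "2 * l / (l - m) = (l + m) / (l - m) + 1" "2 * m / (l - m) = (l + m) / (l - m) - 1"
    using assms by (metis add_divide_distrib divide_self, metis diff_divide_distrib divide_self)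
  thus ?thesis
    unfolding smat_nth rmat_nth eps_def by simp
qed

theorem matrix_rhs_entry:
  fixes g :: "nat \<Rightarrow> ('b::comm_ring_1, 'n::{finite,linorder}) mat1"
  assumes \<kappa>: "unital_hom \<kappa>"
  shows "matrix_rhs \<kappa> g $ (j, p) $ (i, l) = entry_rhs \<kappa> g j i p l"
proof -
  note hom = unital_homD[OF lift2_hom[OF \<kappa>]]
  define u v :: "complex biseries" where
    "u = (lam + mu) / (lam - mu)" and "v = (1 + lam * mu) / (1 - lam * mu)"
  define \<rho> :: "('b biseries, 'n) mat2" where "\<rho> = map_matrix (lift2 \<kappa>) (smat (1 / (lam - mu)) (rmat lam mu))"
  define \<rho>T :: "('b biseries, 'n) mat2" where "\<rho>T = map_matrix (lift2 \<kappa>) (smat (1 / (lam_inv - mu)) (T1 (rmat lam_inv mu)))"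
  define GL where "GL = (\<lambda>a b. ser_lam (\<lambda>k. g k $ a $ b))"
  define GM where "GM = (\<lambda>a b. ser_mu (\<lambda>k. g k $ a $ b))"
  have v: "(lam_inv + mu) / (lam_inv - mu) = v"
  proof -
    have lam: "lam \<noteq> (0 :: complex biseries)"
      using lam_mult_lam_inv by (metis mult_zero_left zero_neq_one)
    have "(lam_inv + mu) / (lam_inv - mu) = (lam * (lam_inv + mu)) / (lam * (lam_inv - mu :: complex biseries))"
      by (rule nonzero_mult_divide_mult_cancel_left[OF lam, symmetric])
    thus ?thesis
      by (simp add: v_def distrib_left right_diff_distrib)
  qed
  have \<rho>: "\<rho> $ (a, b) $ (c, d) = (if a = d \<and> b = c then lift2 \<kappa> (u - eps a b) else 0)" for a b c d
    unfolding \<rho>_def nth_map_matrix rho_nth[OF complex_spectral_differences(1)] u_def by (simp add: hom)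
  have \<rho>T: "\<rho>T $ (a, b) $ (c, d) = (if a = b \<and> c = d then lift2 \<kappa> (v - eps c a) else 0)" for a b c d
  proof -
    have "\<rho>T $ (a, b) $ (c, d) = lift2 \<kappa> (smat (1 / (lam_inv - mu)) (rmat lam_inv mu) $ (c, b) $ (a, d))"
      by (simp add: \<rho>T_def T1_def)
    thus ?thesis
      unfolding rho_nth[OF complex_spectral_differences(2)] v by (auto simp: hom)
  qed
  have 1: "(\<rho> ** (G1 g ** G2 g)) $ (j, p) $ (i, l) = lift2 \<kappa> (u - eps j p) * (GL p i * GM j l)"
  proof -
    have "(\<rho> ** (G1 g ** G2 g)) $ (j, p) $ (i, l)
        = (\<Sum>x\<in>UNIV. if x = (p, j) then lift2 \<kappa> (u - eps j p) * (GL p i * GM j l) else 0)"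
      unfolding matrix_mult_nth[of \<rho>] 
      by (intro sum.cong) (auto simp: \<rho> G1_mult_G2 GL_def GM_def split: if_splits)
    thus ?thesis by simp
  qed
  have 2: "((G1 g ** G2 g) ** \<rho>) $ (j, p) $ (i, l) = lift2 \<kappa> (u - eps l i) * (GL j l * GM p i)"
  proof -
    have "((G1 g ** G2 g) ** \<rho>) $ (j, p) $ (i, l)
        = (\<Sum>x\<in>UNIV. if x = (l, i) then lift2 \<kappa> (u - eps l i) * (GL j l * GM p i) else 0)"
      unfolding matrix_mult_nth[of _ \<rho>] 
      by (intro sum.cong) (auto simp: \<rho> G1_mult_G2 GL_def GM_def mult.commute split: if_splits)
    thus ?thesis by simp
  qed
  have 3: "(G1 g ** \<rho>T ** G2 g) $ (j, p) $ (i, l) = lift2 \<kappa> (v - eps i p) * (GL j p * GM i l)"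
  proof -
    have a: "(G1 g ** \<rho>T) $ (j, p) $ (x, y) = (if x = y then GL j p * lift2 \<kappa> (v - eps x p) else 0)" for x y
    proof -
      have "(G1 g ** \<rho>T) $ (j, p) $ (x, y)
          = (\<Sum>z\<in>UNIV. if z = (p, p) then (if x = y then GL j p * lift2 \<kappa> (v - eps x p) else 0) else 0)"
        unfolding matrix_mult_nth by (intro sum.cong) (auto simp: \<rho>T G1_nth GL_def split: if_splits)
      thus ?thesis by simp
    qed
    have "(G1 g ** \<rho>T ** G2 g) $ (j, p) $ (i, l)
        = (\<Sum>x\<in>UNIV. if x = (i, i) then lift2 \<kappa> (v - eps i p) * (GL j p * GM i l) else 0)"
      unfolding matrix_mult_nth[of _ "G2 g"]
      by (intro sum.cong) (auto simp: a G2_nth GM_def mult_ac split: if_splits)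
    thus ?thesis by simp
  qed
  have 4: "(G2 g ** \<rho>T ** G1 g) $ (j, p) $ (i, l) = lift2 \<kappa> (v - eps l j) * (GL l i * GM p j)"
  proof -
    have a: "(G2 g ** \<rho>T) $ (j, p) $ (x, y) = (if x = y then GM p j * lift2 \<kappa> (v - eps x j) else 0)" for x y
    proof -
      have "(G2 g ** \<rho>T) $ (j, p) $ (x, y)
          = (\<Sum>z\<in>UNIV. if z = (j, j) then (if x = y then GM p j * lift2 \<kappa> (v - eps x j) else 0) else 0)"
        unfolding matrix_mult_nth by (intro sum.cong) (auto simp: \<rho>T G2_nth GM_def split: if_splits)
      thus ?thesis by simp
    qed
    have "(G2 g ** \<rho>T ** G1 g) $ (j, p) $ (i, l)
        = (\<Sum>x\<in>UNIV. if x = (l, l) then lift2 \<kappa> (v - eps l j) * (GL l i * GM p j) else 0)"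
      unfolding matrix_mult_nth[of _ "G1 g"]
      by (intro sum.cong) (auto simp: a G1_nth GL_def mult_ac split: if_splits)
    thus ?thesis by simp
  qed
  have eps: "eps l i = - eps i l" "eps l j = - eps j l"
    by (auto simp: eps_def)
  have "matrix_rhs \<kappa> g $ (j, p) $ (i, l)
      = - (lift2 \<kappa> (u - eps j p) * (GL p i * GM j l) - lift2 \<kappa> (u - eps l i) * (GL j l * GM p i))
        - lift2 \<kappa> (v - eps i p) * (GL j p * GM i l) + lift2 \<kappa> (v - eps l j) * (GL l i * GM p j)"
    unfolding matrix_rhs_def Let_def \<rho>_def[symmetric] \<rho>T_def[symmetric]
    by (simp add: 1 2 3 4)
  thus ?thesis
    unfolding entry_rhs_def Let_def u_def[symmetric] v_def[symmetric] GL_def[symmetric] GM_def[symmetric]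
    by (simp add: hom eps algebra_simps)
qed


section \<open>Evaluation of elements of monoid algebras\<close>

lemma poly_mapping_induct_single [case_names single add]:
  fixes f :: "'k \<Rightarrow>\<^sub>0 'c::comm_monoid_add"
  assumes single: "\<And>k c. Q (Poly_Mapping.single k c)" and add: "\<And>f g. Q f \<Longrightarrow> Q g \<Longrightarrow> Q (f + g)"
  shows "Q f"
proof -
  have Q0: "Q 0"
    using single[of _ 0] by simp
  have "Q (\<Sum>k\<in>S. Poly_Mapping.single k (Poly_Mapping.lookup f k))" if "finite S" for S
    using that by induction (auto intro: single add Q0)
  moreover have "f = (\<Sum>k\<in>Poly_Mapping.keys f. Poly_Mapping.single k (Poly_Mapping.lookup f k))"
    by (rule poly_mapping_eqI) (auto simp: lookup_sum lookup_single when_def in_keys_iff)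
  ultimately show ?thesis
    using finite_keys[of f] by metis
qed

text \<open>
  The homomorphism of a monoid algebra to a ring that extends a map of coefficients and a monoid
  homomorphism.  It serves for polynomials (commutative monoid of monomials) and for the free algebra
  (monoid of words) alike.
\<close>

definition pm_eval :: "('c::zero \<Rightarrow> 'r) \<Rightarrow> ('m \<Rightarrow> 'r) \<Rightarrow> ('m \<Rightarrow>\<^sub>0 'c) \<Rightarrow> 'r::semiring_0" where
  "pm_eval \<kappa> \<phi> f = (\<Sum>m\<in>Poly_Mapping.keys f. \<kappa> (Poly_Mapping.lookup f m) * \<phi> m)"

lemma pm_eval_superset:
  assumes "finite S" "Poly_Mapping.keys f \<subseteq> S" "\<kappa> 0 = 0"
  shows "pm_eval \<kappa> \<phi> f = (\<Sum>m\<in>S. \<kappa> (Poly_Mapping.lookup f m) * \<phi> m)"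
  unfolding pm_eval_def using assms
  by (intro sum.mono_neutral_left) (auto simp: not_in_keys_iff_lookup_eq_zero)

lemma pm_eval_single: "\<kappa> 0 = 0 \<Longrightarrow> pm_eval \<kappa> \<phi> (Poly_Mapping.single m c) = \<kappa> c * \<phi> m"
  by (subst pm_eval_superset[where S = "{m}"]) auto

lemma pm_eval_add:
  assumes "unital_hom \<kappa>"
  shows "pm_eval \<kappa> \<phi> (f + g) = pm_eval \<kappa> \<phi> f + pm_eval \<kappa> \<phi> g"
proof -
  note hom = unital_homD[OF assms]
  have "pm_eval \<kappa> \<phi> h = (\<Sum>m\<in>Poly_Mapping.keys f \<union> Poly_Mapping.keys g. \<kappa> (Poly_Mapping.lookup h m) * \<phi> m)" if "h \<in> {f, g, f + g}" for h
    using that keys_add[of f g] by (intro pm_eval_superset) (auto simp: hom)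
  thus ?thesis
    by (simp add: lookup_add hom distrib_right sum.distrib)
qed

lemma unital_hom_pm_eval:
  fixes \<kappa> :: "'c::ring_1 \<Rightarrow> 'r::ring_1" and \<phi> :: "'m::monoid_add \<Rightarrow> 'r"
  assumes \<kappa>: "unital_hom \<kappa>" and comm: "\<And>c m. \<kappa> c * \<phi> m = \<phi> m * \<kappa> c"
    and \<phi>: "\<phi> 0 = 1" "\<And>u v. \<phi> (u + v) = \<phi> u * \<phi> v"
  shows "unital_hom (pm_eval \<kappa> \<phi>)"
proof -
  note hom = unital_homD[OF \<kappa>]
  note add = pm_eval_add[OF \<kappa>] and single = pm_eval_single[of \<kappa>, OF hom(2)]
  have "pm_eval \<kappa> \<phi> (f * g) = pm_eval \<kappa> \<phi> f * pm_eval \<kappa> \<phi> g" for f g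
  proof (induction f rule: poly_mapping_induct_single)
    case (single u c)
    show ?case
    proof (induction g rule: poly_mapping_induct_single)
      case (single v c')
      have "\<kappa> c * \<kappa> c' * (\<phi> u * \<phi> v) = \<kappa> c * (\<phi> u * \<kappa> c') * \<phi> v"
        by (simp only: comm[symmetric] mult.assoc)
      thus ?case
        by (simp add: mult_single pm_eval_single hom \<phi> mult.assoc)
    qed (simp add: add distrib_left)
  qed (simp add: add distrib_right)
  moreover have "pm_eval \<kappa> \<phi> 1 = 1"
    using single[of \<phi> 0 1] by (simp add: hom \<phi>)
  ultimately show ?thesis
    by (simp add: unital_hom_def add)
qed


section \<open>Derivations and biderivations of polynomial rings\<close>

type_synonym 'g cpoly = "('g \<Rightarrow>\<^sub>0 nat) \<Rightarrow>\<^sub>0 complex"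

abbreviation pconst :: "complex \<Rightarrow> 'g cpoly" where
  "pconst c \<equiv> Poly_Mapping.single 0 c"

definition pvar :: "'g \<Rightarrow> 'g cpoly" where
  "pvar a = Poly_Mapping.single (Poly_Mapping.single a 1) 1"

lemma unital_hom_pconst: "unital_hom pconst"
  by (simp add: unital_hom_def single_add mult_single)

lemma cpoly_induct [case_names const var add mult]:
  fixes f :: "'g cpoly"
  assumes const: "\<And>c. Q (pconst c)" and var: "\<And>a. Q (pvar a)"
    and add: "\<And>f g. Q f \<Longrightarrow> Q g \<Longrightarrow> Q (f + g)" and mult: "\<And>f g. Q f \<Longrightarrow> Q g \<Longrightarrow> Q (f * g)"
  shows "Q f"
proof (induction f rule: poly_mapping_induct_single)
  case (single m c)
  have "Q (Poly_Mapping.single m 1)"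
  proof (induction m rule: poly_mapping_induct_single)
    case (single a n)
    show ?case
    proof (induction n)
      case 0
      show ?case using const[of 1] by simp
    next
      case (Suc n)
      have "Poly_Mapping.single (Poly_Mapping.single a (Suc n)) 1
          = pvar a * Poly_Mapping.single (Poly_Mapping.single a n) (1 :: complex)"
        by (simp add: pvar_def mult_single flip: single_add)
      with Suc show ?case by (simp only: mult var)
    qed
  next
    case (add u v)
    have "Poly_Mapping.single (u + v) 1 = Poly_Mapping.single u 1 * Poly_Mapping.single v (1 :: complex)"
      by (simp add: mult_single)
    with add show ?case by (simp only: mult)
  qed
  moreover have "Poly_Mapping.single m c = pconst c * Poly_Mapping.single m 1"
    by (simp add: mult_single)
  ultimately show ?case by (simp only: mult const)
qed (rule add)

definition derivation :: "('g cpoly \<Rightarrow> 'g cpoly) \<Rightarrow> bool" where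
  "derivation D \<longleftrightarrow> (\<forall>f g. D (f + g) = D f + D g) \<and> (\<forall>c f. D (pconst c * f) = pconst c * D f) \<and>
     (\<forall>f g. D (f * g) = f * D g + D f * g)"

lemma derivationD:
  assumes "derivation D"
  shows "D (f + g) = D f + D g" "D (pconst c * f) = pconst c * D f" "D (f * g) = f * D g + D f * g"
    "D (pconst c) = 0" "D 0 = 0" "D 1 = 0"
proof -
  show add: "D (f + g) = D f + D g" and scal: "D (pconst c * f) = pconst c * D f"
    and mult: "D (f * g) = f * D g + D f * g" for f g c
    using assms by (auto simp: derivation_def)
  show 1: "D 1 = 0"
    using mult[of 1 1] by simp
  show const: "D (pconst c) = 0" for c
    using scal[of c 1] 1 by simp
  show "D 0 = 0"
    using const[of 0] by simp
qed

lemma derivation_eqI: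
  assumes "derivation D" "derivation D'" "\<And>a. D (pvar a) = D' (pvar a)"
  shows "D f = D' f"
  by (induction f rule: cpoly_induct)
    (simp_all add: derivationD[OF assms(1)] derivationD[OF assms(2)] assms(3))

lemma derivation_add:
  assumes "derivation D" "derivation D'"
  shows "derivation (\<lambda>f. D f + D' f)"
  using assms derivationD(4)[OF assms(1)] derivationD(4)[OF assms(2)]
  by (simp add: derivation_def algebra_simps)

lemma derivation_scale:
  assumes "derivation D"
  shows "derivation (\<lambda>f. p * D f)"
  using assms derivationD(4)[OF assms(1)]
  by (simp add: derivation_def algebra_simps)

lemma derivation_uminus:
  assumes "derivation D"
  shows "derivation (\<lambda>f. - D f)"
  using assms derivationD(4)[OF assms(1)]
  by (simp add: derivation_def algebra_simps)

text \<open>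
  A polynomial map \<open>f\<close> satisfies \<open>f(x + \<epsilon> c) = f(x) + \<epsilon> D f(x) + O(\<epsilon>\<^sup>2)\<close>, with \<open>D\<close> the derivation that
  sends each variable \<open>x\<^sub>a\<close> to \<open>c\<^sub>a\<close>.  The substitution is a ring homomorphism, and comparing
  coefficients of \<open>\<epsilon>\<close> turns multiplicativity into the Leibniz rule; \<open>\<epsilon>\<close> is the variable of formal
  power series.
\<close>

lemma derivation_exists:
  fixes c :: "'g \<Rightarrow> 'g cpoly"
  obtains D where "derivation D" "\<And>a. D (pvar a) = c a"
proof -
  define x where "x = (\<lambda>a. fps_const (pvar a) + fps_X * fps_const (c a))"
  define \<phi> where "\<phi> = (\<lambda>m :: 'g \<Rightarrow>\<^sub>0 nat. \<Prod>a\<in>Poly_Mapping.keys m. x a ^ Poly_Mapping.lookup m a)"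
  define \<kappa> where "\<kappa> = (\<lambda>z. fps_const (pconst z :: 'g cpoly))"
  define ev where "ev = pm_eval \<kappa> \<phi>"
  have \<phi>_superset: "\<phi> m = (\<Prod>a\<in>S. x a ^ Poly_Mapping.lookup m a)" if "finite S" "Poly_Mapping.keys m \<subseteq> S" for m S
    unfolding \<phi>_def using that
    by (intro prod.mono_neutral_left) (auto simp: not_in_keys_iff_lookup_eq_zero)
  have "\<phi> (u + v) = \<phi> u * \<phi> v" for u v
  proof -
    have "\<phi> m = (\<Prod>a\<in>Poly_Mapping.keys u \<union> Poly_Mapping.keys v. x a ^ Poly_Mapping.lookup m a)" if "m \<in> {u, v, u + v}" for m
      using that keys_add[of u v] by (intro \<phi>_superset) auto
    thus ?thesis
      by (simp add: lookup_add power_add prod.distrib)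
  qed
  moreover have \<kappa>: "unital_hom \<kappa>"
    unfolding \<kappa>_def unital_hom_def by (simp add: single_add mult_single)
  ultimately have ev: "unital_hom ev"
    unfolding ev_def by (intro unital_hom_pm_eval) (auto simp: \<phi>_def mult.commute)
  note hom = unital_homD[OF ev]
  have ev_const: "ev (pconst z) = \<kappa> z" for z
    unfolding ev_def using unital_homD(2)[OF \<kappa>] by (simp add: pm_eval_single \<phi>_def)
  have ev_var: "ev (pvar a) = x a" for a
    unfolding ev_def pvar_def using unital_homD(1,2)[OF \<kappa>] by (simp add: pm_eval_single \<phi>_def)
  have ev_0: "fps_nth (ev f) 0 = f" for f
    by (induction f rule: cpoly_induct) (simp_all add: ev_const ev_var hom \<kappa>_def x_def)
  define D where "D = (\<lambda>f. fps_nth (ev f) 1)"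
  have "derivation D"
    unfolding derivation_def D_def
    by (simp add: hom ev_const \<kappa>_def fps_mult_nth_1 ev_0 add.commute)
  moreover have "D (pvar a) = c a" for a
    by (simp add: D_def ev_var x_def)
  ultimately show thesis
    using that by blast
qed

text \<open>
  A bracket is determined by its values on pairs of variables: extend in one argument first, which
  gives the derivations \<open>{_, x\<^sub>a}\<close>, then in the other.  That the result is again skew follows by
  applying uniqueness of derivations in each argument.
\<close>

lemma biderivation_exists:
  fixes c :: "'g \<Rightarrow> 'g \<Rightarrow> 'g cpoly"
  assumes skew: "\<And>a b. c a b = - c b a"
  obtains pb where "\<And>f g. pb f g = - pb g f" "\<And>g. derivation (\<lambda>f. pb f g)"
    "\<And>a b. pb (pvar a) (pvar b) = c a b"
proof -
  have "\<exists>D. derivation D \<and> (\<forall>a. D (pvar a) = v a)" for v :: "'g \<Rightarrow> 'g cpoly"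
    by (rule derivation_exists[of v]) blast
  then obtain Der where Der: "\<And>v. derivation (Der v)" "\<And>v a. Der v (pvar a) = (v a :: 'g cpoly)"
    by metis
  define pb where "pb = (\<lambda>f g. Der (\<lambda>a. - Der (\<lambda>b. c b a) g) f)"
  have left: "derivation (\<lambda>f. pb f g)" for g
    using Der(1) by (simp add: pb_def)
  have pb_var: "pb (pvar a) g = - Der (\<lambda>b. c b a) g" for a g
    by (simp add: pb_def Der)
  note inner = derivationD[OF Der(1)]
  have "derivation (\<lambda>g. pb f g)" for f
    unfolding derivation_def
  proof (intro conjI allI)
    fix g g' z
    show "pb f (g + g') = pb f g + pb f g'"
      by (rule derivation_eqI[OF left derivation_add[OF left left]]) (simp add: pb_var inner)
    show "pb f (pconst z * g) = pconst z * pb f g"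
      by (rule derivation_eqI[OF left derivation_scale[OF left]]) (simp add: pb_var inner(2))
    have "derivation (\<lambda>f. g * pb f g' + g' * pb f g)"
      by (intro derivation_add derivation_scale left)
    from derivation_eqI[OF left this, of "g * g'" f]
    show "pb f (g * g') = g * pb f g' + pb f g * g'"
      by (simp add: pb_var inner(3) mult.commute)
  qed
  note right = this
  have var: "pb (pvar a) g = - pb g (pvar a)" for a g
    by (rule derivation_eqI[OF right derivation_uminus[OF left]])
      (simp add: pb_var Der skew[of _ a])
  have skew': "pb f g = - pb g f" for f g
    by (rule derivation_eqI[OF left derivation_uminus[OF right]]) (rule var)
  show thesis
  proof (rule that[OF _ left])
    show "pb f g = - pb g f" for f g
      by (rule skew')
    show "pb (pvar a) (pvar b) = c a b" for a b
      using skew[of a b] by (simp add: pb_var Der)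
  qed
qed


section \<open>The defining bracket is a power series\<close>

lemma biser_inject: "biser c = biser c' \<longleftrightarrow> c = c'"
proof
  assume eq: "biser c = biser c'"
  show "c = c'"
  proof (intro ext)
    fix k m
    show "c k m = c' k m"
      using arg_cong[OF eq, of "\<lambda>F. F $$ int m $$ int k"] by (simp add: biser_nth)
  qed
qed simp

lemma biser_arith:
  "biser a + biser b = biser (\<lambda>k m. a k m + b k m)" "biser a - biser b = biser (\<lambda>k m. a k m - b k m)"
  by (simp_all add: fls_eq_iff biser_nth)

text \<open>
  Coefficients of \<open>(\<lambda> + \<mu>)/(\<lambda> - \<mu>) \<cdot> \<Sum> a\<^sub>k\<^sub>m \<lambda>\<^sup>-\<^sup>k \<mu>\<^sup>-\<^sup>m\<close> for antisymmetric \<open>a\<close>.  The factor expands as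
  \<open>- 1 - 2 \<Sum>\<^sub>t (\<lambda>/\<mu>)\<^sup>t\<close> over \<open>t \<ge> 1\<close>, so the product is a sum along an antidiagonal.  Antisymmetry cancels
  the positive powers of \<open>\<lambda>\<close>, which is why the product is a power series although the factor is not.
\<close>

definition ucoef :: "(nat \<Rightarrow> nat \<Rightarrow> 'b::comm_ring_1) \<Rightarrow> nat \<Rightarrow> nat \<Rightarrow> 'b" where
  "ucoef a k m = - a k m - 2 * (\<Sum>i=Suc k..k+m. a i (k + m - i))"

text \<open>
  Likewise for \<open>(1 + \<lambda>\<mu>)/(1 - \<lambda>\<mu>) = - 1 - 2 \<Sum>\<^sub>t (\<lambda>\<mu>)\<^sup>-\<^sup>t\<close> with \<open>t \<ge> 1\<close>, which is a power series in
  \<open>\<lambda>\<^sup>-\<^sup>1\<close> and \<open>\<mu>\<^sup>-\<^sup>1\<close> to begin with.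
\<close>

definition vcoef :: "(nat \<Rightarrow> nat \<Rightarrow> 'b::comm_ring_1) \<Rightarrow> nat \<Rightarrow> nat \<Rightarrow> 'b" where
  "vcoef b k m = - b k m - 2 * (\<Sum>t=1..min k m. b (k - t) (m - t))"

lemma antisymmetric_diagonal_sum:
  fixes a :: "nat \<Rightarrow> nat \<Rightarrow> 'b::comm_ring_1"
  assumes "\<And>k m. a k m = - a m k"
  shows "2 * (\<Sum>i=0..n. a i (n - i)) = 0"
proof -
  have "(\<Sum>i=0..n. a i (n - i)) = (\<Sum>i=0..n. a (n - i) i)"
    by (rule sum.reindex_bij_witness[of _ "\<lambda>i. n - i" "\<lambda>i. n - i"]) auto
  also have "\<dots> = (\<Sum>i=0..n. - a i (n - i))"
    by (intro sum.cong refl) (rule assms)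
  finally have "(\<Sum>i=0..n. a i (n - i)) = - (\<Sum>i=0..n. a i (n - i))"
    by (simp only: sum_negf)
  thus ?thesis
    unfolding mult_2 eq_neg_iff_add_eq_0 .
qed

lemma ucoef_0:
  assumes "\<And>k m. a k m = - a m k"
  shows "ucoef a 0 m = a 0 m"
proof -
  have "2 * a 0 m + 2 * (\<Sum>i=1..m. a i (m - i)) = 0"
    using antisymmetric_diagonal_sum[of a m, OF assms]
    by (simp add: sum.atLeast_Suc_atMost distrib_left)
  hence "2 * (\<Sum>i=1..m. a i (m - i)) = - (2 * a 0 m)"
    by (simp add: eq_neg_iff_add_eq_0 add.commute)
  thus ?thesis
    by (simp add: ucoef_def)
qed

lemma ucoef_Suc: "ucoef a (Suc k) m - ucoef a k (Suc m) = a (Suc k) m + a k (Suc m)"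
proof -
  have "(\<Sum>i=Suc k..Suc (k+m). a i (Suc (k + m) - i))
      = a (Suc k) m + (\<Sum>i=Suc (Suc k)..Suc (k+m). a i (Suc (k + m) - i))"
    by (subst sum.atLeast_Suc_atMost) auto
  thus ?thesis
    by (simp add: ucoef_def algebra_simps)
qed

text \<open>
  Expanding \<open>(\<lambda> + \<mu>)/(\<lambda> - \<mu>)\<close> in powers of \<open>\<mu>/\<lambda>\<close> instead would give the sum over the other part of the
  antidiagonal.  The two differ by twice the full antidiagonal sum, which is zero; hence the bracket
  is skew although the expansion treats \<open>\<lambda>\<close> and \<open>\<mu>\<close> differently.
\<close>

lemma ucoef_commute:
  assumes "\<And>k m. a k m = - a m k"
  shows "ucoef a k m = ucoef a m k"
proof -
  define n where "n = k + m"
  define f where "f = (\<lambda>i. a i (n - i))"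
  have f: "f (n - i) = - f i" if "i \<le> n" for i
    using that assms[of "n - i" i] by (simp add: f_def)
  have "(\<Sum>i=Suc m..n. f i) = (\<Sum>i\<in>{0..<k}. f (n - i))"
    by (rule sum.reindex_bij_witness[of _ "\<lambda>i. n - i" "\<lambda>i. n - i"]) (auto simp: n_def)
  also have "\<dots> = - (\<Sum>i\<in>{0..<k}. f i)"
    unfolding sum_negf[symmetric] by (intro sum.cong refl f) (simp add: n_def)
  finally have 1: "(\<Sum>i=Suc m..n. f i) = - (\<Sum>i\<in>{0..<k}. f i)" .
  have "(\<Sum>i=0..n. f i) = (\<Sum>i\<in>{0..<k}. f i) + (\<Sum>i=k..n. f i)"
    by (subst sum.union_disjoint[symmetric]) (auto intro!: sum.cong simp: n_def)
  also have "(\<Sum>i=k..n. f i) = f k + (\<Sum>i=Suc k..n. f i)"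
    by (intro sum.atLeast_Suc_atMost) (simp add: n_def)
  finally have "2 * (\<Sum>i\<in>{0..<k}. f i) + 2 * f k + 2 * (\<Sum>i=Suc k..n. f i) = 0"
    using antisymmetric_diagonal_sum[of a n, OF assms] by (simp add: f_def algebra_simps)
  hence 2: "2 * (\<Sum>i\<in>{0..<k}. f i) = - (2 * f k) - 2 * (\<Sum>i=Suc k..n. f i)"
    by (simp add: algebra_simps eq_neg_iff_add_eq_0)
  have "ucoef a m k = - f m - 2 * (\<Sum>i=Suc m..n. f i)"
    by (simp add: ucoef_def f_def n_def add.commute)
  also have "f m = - f k"
    using f[of k] by (simp add: n_def)
  also have "- (- f k) - 2 * (\<Sum>i=Suc m..n. f i) = f k + 2 * (\<Sum>i\<in>{0..<k}. f i)"
    by (simp add: 1)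
  also have "\<dots> = - f k - 2 * (\<Sum>i=Suc k..n. f i)"
    by (simp add: 2)
  also have "\<dots> = ucoef a k m"
    by (simp add: ucoef_def f_def n_def)
  finally show ?thesis ..
qed

lemma vcoef_0: "vcoef b 0 m = - b 0 m" "vcoef b k 0 = - b k 0"
  by (simp_all add: vcoef_def)

lemma vcoef_Suc: "vcoef b k m - vcoef b (Suc k) (Suc m) = b k m + b (Suc k) (Suc m)"
proof -
  have "(\<Sum>t=1..Suc (min k m). b (Suc k - t) (Suc m - t))
      = b k m + (\<Sum>t=Suc 1..Suc (min k m). b (Suc k - t) (Suc m - t))"
    using sum.atLeast_Suc_atMost[of 1 "Suc (min k m)" "\<lambda>t. b (Suc k - t) (Suc m - t)"]
    by (simp only: One_nat_def diff_Suc_Suc diff_zero Suc_le_mono le0 simp_thms)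
  also have "(\<Sum>t=Suc 1..Suc (min k m). b (Suc k - t) (Suc m - t)) = (\<Sum>t=1..min k m. b (k - t) (m - t))"
    by (simp only: sum.shift_bounds_cl_Suc_ivl diff_Suc_Suc)
  finally show ?thesis
    by (simp add: vcoef_def algebra_simps)
qed

lemma int_cases_minus1:
  fixes k :: int
  obtains "k < -1" | "k = -1" | k' where "k = int k'"
proof -
  consider "k < -1" | "k = -1" | "0 \<le> k"
    by linarith
  thus thesis
    using that by cases (auto elim: nonneg_int_cases)
qed

lemma lam_minus_mu_ucoef:
  fixes a :: "nat \<Rightarrow> nat \<Rightarrow> 'b::comm_ring_1"
  assumes "\<And>k m. a k m = - a m k"
  shows "(lam - mu) * biser (ucoef a) = (lam + mu) * biser a"
proof (rule biseries_eqI)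
  fix m k :: int
  have 0: "ucoef a k 0 = - a k 0" for k
    by (simp add: ucoef_def)
  have nat: "nat (1 + int i) = Suc i" "nat (int i + 1) = Suc i" for i
    by auto
  show "((lam - mu) * biser (ucoef a)) $$ m $$ k = ((lam + mu) * biser a) $$ m $$ k"
    unfolding left_diff_distrib distrib_right fls_minus_nth fls_plus_nth lam_mult_nth mu_mult_nth
    by (cases m rule: int_cases_minus1; cases k rule: int_cases_minus1)
      (simp_all add: biser_nth nat ucoef_0[OF assms] ucoef_Suc 0)
qed

lemma one_minus_lam_mu_vcoef:
  fixes b :: "nat \<Rightarrow> nat \<Rightarrow> 'b::comm_ring_1"
  shows "(1 - lam * mu) * biser (vcoef b) = (1 + lam * mu) * biser b"
proof (rule biseries_eqI)
  fix m k :: int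
  have nat: "nat (1 + int i) = Suc i" "nat (int i + 1) = Suc i" for i
    by auto
  show "((1 - lam * mu) * biser (vcoef b)) $$ m $$ k = ((1 + lam * mu) * biser b) $$ m $$ k"
    unfolding left_diff_distrib distrib_right fls_minus_nth fls_plus_nth mult.assoc lam_mult_nth
      mu_mult_nth mult_1_left
    by (cases m rule: int_cases_minus1; cases k rule: int_cases_minus1)
      (simp_all add: biser_nth nat vcoef_0 vcoef_Suc)
qed

lemma lift2_divide_eqI:
  fixes x y :: "'b::comm_ring_1 biseries"
  assumes \<kappa>: "unital_hom \<kappa>" and d: "d \<noteq> 0" and eq: "lift2 \<kappa> d * y = lift2 \<kappa> n * x"
  shows "lift2 \<kappa> (n / d) * x = y"
proof -
  note hom = unital_homD[OF lift2_hom[OF \<kappa>]]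
  have "1 / d * d = 1" "n / d = 1 / d * n"
    using d by simp_all
  hence inv: "lift2 \<kappa> (1 / d) * lift2 \<kappa> d = 1" and "lift2 \<kappa> (n / d) = lift2 \<kappa> (1 / d) * lift2 \<kappa> n"
    by (metis hom(1,6))+
  hence "lift2 \<kappa> (n / d) * x = lift2 \<kappa> (1 / d) * (lift2 \<kappa> d * y)"
    by (simp only: eq mult.assoc)
  thus ?thesis
    by (simp only: inv mult.assoc[symmetric] mult_1_left)
qed

lemma lift2_u_biser:
  fixes a :: "nat \<Rightarrow> nat \<Rightarrow> 'b::comm_ring_1"
  assumes \<kappa>: "unital_hom \<kappa>" and a: "\<And>k m. a k m = - a m k"
  shows "lift2 \<kappa> ((lam + mu) / (lam - mu)) * biser a = biser (ucoef a)"
  by (rule lift2_divide_eqI[OF \<kappa> complex_spectral_differences(1)])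
    (simp only: unital_homD[OF lift2_hom[OF \<kappa>]] lift2_spectral[OF \<kappa>] lam_minus_mu_ucoef[of a, OF a])

lemma lift2_v_biser:
  fixes b :: "nat \<Rightarrow> nat \<Rightarrow> 'b::comm_ring_1"
  assumes \<kappa>: "unital_hom \<kappa>"
  shows "lift2 \<kappa> ((1 + lam * mu) / (1 - lam * mu)) * biser b = biser (vcoef b)"
  by (rule lift2_divide_eqI[OF \<kappa> complex_spectral_differences(3)])
    (simp only: unital_homD[OF lift2_hom[OF \<kappa>]] lift2_spectral[OF \<kappa>] one_minus_lam_mu_vcoef)

definition sg :: "'n::linorder \<Rightarrow> 'n \<Rightarrow> 'b::comm_ring_1" where
  "sg i j = (if i < j then - 1 else if i = j then 0 else 1)"

lemma sg_swap: "sg j i = - sg i j"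
  by (auto simp: sg_def)

lemma lift2_eps_biser:
  assumes \<kappa>: "unital_hom \<kappa>"
  shows "lift2 \<kappa> (eps i j) * biser c = biser (\<lambda>k m. sg i j * c k m)"
  by (auto simp: eps_def sg_def unital_homD[OF lift2_hom[OF \<kappa>]] biser_nth intro!: biseries_eqI)

text \<open>
  The coefficient of \<open>\<lambda>\<^sup>-\<^sup>k \<mu>\<^sup>-\<^sup>m\<close> in the entrywise bracket, after collecting the terms with
  \<open>(\<lambda> + \<mu>)/(\<lambda> - \<mu>)\<close> and those with \<open>(1 + \<lambda>\<mu>)/(1 - \<lambda>\<mu>)\<close>.
\<close>

definition entry_coeff :: "(nat \<Rightarrow> ('b::comm_ring_1, 'n::{finite,linorder}) mat1)
    \<Rightarrow> 'n \<Rightarrow> 'n \<Rightarrow> 'n \<Rightarrow> 'n \<Rightarrow> nat \<Rightarrow> nat \<Rightarrow> 'b" where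
  "entry_coeff g j i p l k m =
     sg j p * (g k $ p $ i * g m $ j $ l) + sg i l * (g m $ p $ i * g k $ j $ l)
   + ucoef (\<lambda>k m. g m $ p $ i * g k $ j $ l - g k $ p $ i * g m $ j $ l) k m
   + sg i p * (g k $ j $ p * g m $ i $ l) + sg j l * (g k $ l $ i * g m $ p $ j)
   + vcoef (\<lambda>k m. g k $ l $ i * g m $ p $ j - g k $ j $ p * g m $ i $ l) k m"

lemma entry_rhs_biser:
  fixes g :: "nat \<Rightarrow> ('b::comm_ring_1, 'n::{finite,linorder}) mat1"
  assumes \<kappa>: "unital_hom \<kappa>"
  shows "entry_rhs \<kappa> g j i p l = biser (entry_coeff g j i p l)"
proof -
  note hom = unital_homD[OF lift2_hom[OF \<kappa>]]
  define u v :: "'b biseries" where "u = lift2 \<kappa> ((lam + mu) / (lam - mu))"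
    and "v = lift2 \<kappa> ((1 + lam * mu) / (1 - lam * mu))"
  define a where "a = (\<lambda>k m. g m $ p $ i * g k $ j $ l - g k $ p $ i * g m $ j $ l)"
  define b where "b = (\<lambda>k m. g k $ l $ i * g m $ p $ j - g k $ j $ p * g m $ i $ l)"
  have u: "u * biser a = biser (ucoef a)"
    unfolding u_def by (rule lift2_u_biser[OF \<kappa>]) (simp add: a_def mult.commute)
  have v: "v * biser b = biser (vcoef b)"
    unfolding v_def by (rule lift2_v_biser[OF \<kappa>])
  have regroup: "(e1 - u) * A + (e2 + u) * B + (e3 - v) * C + (e4 + v) * D
      = e1 * A + e2 * B + u * (B - A) + e3 * C + e4 * D + v * (D - C)" for e1 e2 e3 e4 A B C D
    by (simp add: algebra_simps)
  have "entry_rhs \<kappa> g j i p l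
    = lift2 \<kappa> (eps j p) * biser (\<lambda>k m. g k $ p $ i * g m $ j $ l)
    + lift2 \<kappa> (eps i l) * biser (\<lambda>k m. g m $ p $ i * g k $ j $ l) + u * biser a
    + lift2 \<kappa> (eps i p) * biser (\<lambda>k m. g k $ j $ p * g m $ i $ l)
    + lift2 \<kappa> (eps j l) * biser (\<lambda>k m. g k $ l $ i * g m $ p $ j) + v * biser b"
    unfolding entry_rhs_def Let_def a_def b_def biser_arith(2)[symmetric] hom u_def[symmetric] v_def[symmetric]
      mult.assoc ser_lam_mult_ser_mu ser_mu_mult_ser_lam
    by (rule regroup)
  thus ?thesis
    unfolding lift2_eps_biser[OF \<kappa>] u v biser_arith
    unfolding entry_coeff_def a_def[symmetric] b_def[symmetric] .
qed

lemma entry_coeff_skew: "entry_coeff g j i p l k m = - entry_coeff g p l j i m k"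
proof -
  define a where "a = (\<lambda>k m. g m $ p $ i * g k $ j $ l - g k $ p $ i * g m $ j $ l)"
  define b where "b = (\<lambda>k m. g k $ l $ i * g m $ p $ j - g k $ j $ p * g m $ i $ l)"
  have "ucoef (\<lambda>k m. g m $ j $ l * g k $ p $ i - g k $ j $ l * g m $ p $ i) m k = - ucoef a m k"
    by (simp add: ucoef_def a_def mult.commute sum_subtractf algebra_simps)
  also have "ucoef a m k = ucoef a k m"
    by (rule ucoef_commute) (simp add: a_def mult.commute)
  finally have u: "ucoef (\<lambda>k m. g m $ j $ l * g k $ p $ i - g k $ j $ l * g m $ p $ i) m k = - ucoef a k m" .
  have v: "vcoef (\<lambda>k m. g k $ i $ l * g m $ j $ p - g k $ p $ j * g m $ l $ i) m k = - vcoef b k m"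
    by (simp add: vcoef_def b_def mult.commute sum_subtractf algebra_simps min.commute)
  show ?thesis
    unfolding entry_coeff_def u v a_def[symmetric] b_def[symmetric] sg_swap[of j p] sg_swap[of p i]
      sg_swap[of l i] sg_swap[of l j]
    by (simp add: algebra_simps)
qed

text \<open>
  The constant generators are scalars, so their brackets have to vanish; for the brackets prescribed
  here this holds because the constant matrix is upper unitriangular.
\<close>

lemma entry_coeff_const:
  fixes g :: "nat \<Rightarrow> ('b::comm_ring_1, 'n::{finite,linorder}) mat1"
  assumes lower: "\<And>a b. b < a \<Longrightarrow> g 0 $ a $ b = 0" and diag: "\<And>a. g 0 $ a $ a = 1" and ij: "i \<le> j"
  shows "entry_coeff g j i p l 0 m = 0"
proof -
  have 1: "(sg j p - 1) * g 0 $ p $ i = (if p = i \<and> j = i then - 1 else 0)"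
    using ij lower[of i p] diag[of i] by (cases p i rule: linorder_cases) (auto simp: sg_def)
  have 2: "(sg i l + 1) * g 0 $ j $ l = (if l = i \<and> j = i then 1 else 0)"
    using ij lower[of l j] diag[of j] by (cases l j rule: linorder_cases) (auto simp: sg_def)
  have 3: "(sg i p + 1) * g 0 $ j $ p = (if p = i \<and> j = i then 1 else 0)"
    using ij lower[of p j] diag[of j] by (cases p j rule: linorder_cases) (auto simp: sg_def)
  have 4: "(sg j l - 1) * g 0 $ l $ i = (if l = i \<and> j = i then - 1 else 0)"
    using ij lower[of i l] diag[of i] by (cases l i rule: linorder_cases) (auto simp: sg_def)
  have "ucoef (\<lambda>k m. g m $ p $ i * g k $ j $ l - g k $ p $ i * g m $ j $ l) 0 m
      = g m $ p $ i * g 0 $ j $ l - g 0 $ p $ i * g m $ j $ l"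
    by (rule ucoef_0) (simp add: mult.commute)
  hence "entry_coeff g j i p l 0 m =
      ((sg j p - 1) * g 0 $ p $ i) * g m $ j $ l + ((sg i l + 1) * g 0 $ j $ l) * g m $ p $ i
    + ((sg i p + 1) * g 0 $ j $ p) * g m $ i $ l + ((sg j l - 1) * g 0 $ l $ i) * g m $ p $ j"
    by (simp add: entry_coeff_def vcoef_0 algebra_simps)
  also have "\<dots> = 0"
    unfolding 1 2 3 4 by auto
  finally show ?thesis .
qed


section \<open>Existence and uniqueness of the Poisson bracket\<close>

lemma unital_hom_DD_const: "unital_hom DD_const"
  by (simp add: unital_hom_def DD_const_def single_add mult_single)

lemma DD_gen_cases:
  fixes i j :: "'n::{finite,linorder}"
  obtains (gen) a where "DD_gen k $ j $ i = pvar a" "dgen_index a = (k, j, i)"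
  | (const) z where "DD_gen k $ j $ i = pconst z" "k = 0" "i \<le> j"
proof (cases "k \<ge> 1 \<or> j < i")
  case True
  hence "dgen_index (dgen (k, j, i)) = (k, j, i)"
    by (intro dgen_inverse) auto
  thus thesis
    using gen[of "dgen (k, j, i)"] True by (simp add: DD_gen_def pvar_def)
next
  case False
  thus thesis
    using const[of "if i = j then 1 else 0"] by (auto simp: DD_gen_def)
qed

lemma pvar_DD_gen: "dgen_index a = (k, j, i) \<Longrightarrow> DD_gen k $ j $ i = pvar a"
proof -
  assume a: "dgen_index a = (k, j, i)"
  hence "dgen (k, j, i) = a"
    by (metis dgen_index_inverse)
  thus ?thesis
    using dgen_index[of a] a by (simp add: DD_gen_def pvar_def)
qed

lemma entry_coeff_DD_const:
  assumes "i \<le> j"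
  shows "entry_coeff DD_gen j i p l 0 m = 0"
  using assms by (intro entry_coeff_const) (auto simp: DD_gen_def)

lemma DD_bracket_entry:
  assumes "DD_bracket pb"
  shows "pb (DD_gen k $ j $ i) (DD_gen m $ p $ l) = entry_coeff DD_gen j i p l k m"
proof -
  have "biser (\<lambda>k m. pb (DD_gen k $ j $ i) (DD_gen m $ p $ l)) = entry_rhs DD_const DD_gen j i p l"
    using assms unfolding DD_bracket_def by blast
  thus ?thesis
    unfolding entry_rhs_biser[OF unital_hom_DD_const] biser_inject by (rule fun_cong[OF fun_cong])
qed

lemma DD_bracketD:
  assumes "DD_bracket pb"
  shows "pb f g = - pb g f" "derivation (\<lambda>f. pb f g)" "derivation (\<lambda>g. pb f g)"
proof -
  show skew: "pb f g = - pb g f" for f g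
    using assms unfolding DD_bracket_def by blast
  show left: "derivation (\<lambda>f. pb f g)" for g
    using assms unfolding DD_bracket_def derivation_def DD_const_def by blast
  have "(\<lambda>g. pb f g) = (\<lambda>g. - pb g f)"
    by (rule ext) (rule skew)
  thus "derivation (\<lambda>g. pb f g)"
    using derivation_uminus[OF left[of f]] by simp
qed

theorem DD_bracket_unique:
  assumes "DD_bracket pb" "DD_bracket pb'"
  shows "pb = pb'"
proof (intro ext)
  fix f g
  note D = DD_bracketD[OF assms(1)] and D' = DD_bracketD[OF assms(2)]
  have gens: "pb (pvar a) (pvar b) = pb' (pvar a) (pvar b)" for a b
  proof -
    obtain k j i m p l where "dgen_index a = (k, j, i)" "dgen_index b = (m, p, l)"
      by (metis prod_cases3)
    hence "DD_gen k $ j $ i = pvar a" "DD_gen m $ p $ l = pvar b"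
      by (auto intro: pvar_DD_gen)
    thus ?thesis
      using DD_bracket_entry[OF assms(1), of k j i m p l] DD_bracket_entry[OF assms(2), of k j i m p l]
      by simp
  qed
  have "pb (pvar a) g = pb' (pvar a) g" for a
    by (rule derivation_eqI[OF D(3) D'(3)]) (rule gens)
  thus "pb f g = pb' f g"
    by (rule derivation_eqI[OF D(2) D'(2)])
qed

text \<open>
  The prescribed values are skew on the free generators, so they extend to a biderivation.  The
  prescription also covers the constant entries of \<open>\<A>\<^sup>(\<^sup>0\<^sup>)\<close>, where it agrees with the extension because
  both sides vanish.
\<close>

theorem DD_bracket_exists: "\<exists>pb :: 'n::{finite,linorder} DD \<Rightarrow> 'n DD \<Rightarrow> 'n DD. DD_bracket pb"
proof -
  define c :: "'n dgen \<Rightarrow> 'n dgen \<Rightarrow> 'n DD" where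
    "c = (\<lambda>a b. case dgen_index a of (k, j, i) \<Rightarrow> case dgen_index b of (m, p, l) \<Rightarrow> entry_coeff DD_gen j i p l k m)"
  have c_skew: "c a b = - c b a" for a b
    unfolding c_def by (auto split: prod.split intro: entry_coeff_skew)
  obtain pb where skew: "\<And>f g. pb f g = - pb g f" and der: "\<And>g. derivation (\<lambda>f. pb f g)"
    and gens: "\<And>a b. pb (pvar a) (pvar b) = c a b"
    using biderivation_exists[of c, OF c_skew] by blast
  have zero: "pb (pconst z) f = 0" "pb f (pconst z) = 0" for z f
    using derivationD(4)[OF der] skew[of f "pconst z"] by auto
  have entry: "pb (DD_gen k $ j $ i) (DD_gen m $ p $ l) = entry_coeff DD_gen j i p l k m" for k j i m p l
  proof (cases k j i rule: DD_gen_cases)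
    case (const z)
    thus ?thesis by (simp add: entry_coeff_DD_const zero)
  next
    case a: (gen a)
    show ?thesis
    proof (cases m p l rule: DD_gen_cases)
      case (const z)
      thus ?thesis
        using entry_coeff_skew[of DD_gen j i p l k m] by (simp add: entry_coeff_DD_const zero)
    next
      case (gen b)
      with a show ?thesis by (simp add: gens c_def)
    qed
  qed
  have "DD_bracket pb"
    unfolding DD_bracket_def DD_const_def
  proof (intro conjI allI)
    show "pb f g = - pb g f" for f g by (rule skew)
    show "pb (f + g) h = pb f h + pb g h" for f g h by (rule derivationD(1)[OF der])
    show "pb (pconst z * f) g = pconst z * pb f g" for z f g by (rule derivationD(2)[OF der])
    show "pb (f * g) h = f * pb g h + pb f h * g" for f g h by (rule derivationD(3)[OF der])
    show "biser (\<lambda>k m. pb (DD_gen k $ j $ i) (DD_gen m $ p $ l)) = entry_rhs (Poly_Mapping.single 0) DD_gen j i p l" for j i p l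
      unfolding entry entry_rhs_biser[OF unital_hom_pconst] ..
  qed
  thus ?thesis by blast
qed


section \<open>The free algebra and its classical projection\<close>

lemma unital_hom_free_const: "unital_hom free_const"
  by (simp add: unital_hom_def free_const_def single_add mult_single)

lemma free_const_central: "free_const c * f = f * free_const c"
proof (induction f rule: poly_mapping_induct_single)
  case (single w c')
  show ?case by (simp add: free_const_def mult_single mult.commute)
qed (simp add: distrib_left distrib_right)

definition word :: "(nat \<times> 'n \<times> 'n) list \<Rightarrow> 'n free_alg" where
  "word xs = Poly_Mapping.single (NCWord xs) 1"

lemma word_Nil: "word [] = 1"
  by (simp add: word_def flip: zero_nc_word_def)

lemma word_append: "word (xs @ ys) = word xs * word ys"
  by (simp add: word_def mult_single plus_nc_word_def)

lemma word_Cons: "word (x # xs) = word [x] * word xs"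
  using word_append[of "[x]" xs] by simp

lemma free_gen_word: "free_gen k $ i $ j = word [(k, i, j)]"
  by (simp add: free_gen_def word_def)

lemma free_alg_single: "Poly_Mapping.single w c = free_const c * word (letters w)"
  by (simp add: free_const_def word_def mult_single)

lemma free_alg_induct [case_names const gen add mult]:
  fixes f :: "'n::finite free_alg"
  assumes const: "\<And>c. Q (free_const c)" and gen: "\<And>k i j. Q (free_gen k $ i $ j)"
    and add: "\<And>f g. Q f \<Longrightarrow> Q g \<Longrightarrow> Q (f + g)" and mult: "\<And>f g. Q f \<Longrightarrow> Q g \<Longrightarrow> Q (f * g)"
  shows "Q f"
proof (induction f rule: poly_mapping_induct_single)
  case (single w c)
  have "Q (word xs)" for xs
  proof (induction xs)
    case Nil
    show ?case using const[of 1] by (simp add: word_Nil unital_homD(1)[OF unital_hom_free_const])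
  next
    case (Cons x xs)
    obtain k i j where "x = (k, i, j)" by (cases x)
    hence "Q (word [x])" using gen by (simp add: free_gen_word)
    with Cons show ?case by (subst word_Cons) (rule mult)
  qed
  thus ?case unfolding free_alg_single by (intro mult const)
qed (rule add)

definition DD_proj :: "'n::{finite,linorder} free_alg \<Rightarrow> 'n DD" where
  "DD_proj = pm_eval (\<lambda>c. DD_const (fps_nth c 0))
     (\<lambda>w. prod_list (map (\<lambda>(k, i, j). DD_gen k $ i $ j) (letters w)))"

lemma unital_hom_DD_const_nth: "unital_hom (\<lambda>c. DD_const (fps_nth c 0))"
  by (simp add: unital_hom_def DD_const_def single_add mult_single)

lemma DD_const_0_1 [simp]: "DD_const 0 = 0" "DD_const 1 = 1"
  by (simp_all add: DD_const_def)

lemma unital_hom_DD_proj: "unital_hom DD_proj"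
  unfolding DD_proj_def
  by (rule unital_hom_pm_eval[OF unital_hom_DD_const_nth])
    (simp_all add: mult.commute zero_nc_word_def plus_nc_word_def)

lemma DD_proj_const: "DD_proj (free_const c) = DD_const (fps_nth c 0)"
  by (simp add: DD_proj_def free_const_def pm_eval_single zero_nc_word_def)

lemma DD_proj_gen: "DD_proj (free_gen k $ i $ j) = DD_gen k $ i $ j"
  by (simp add: DD_proj_def free_gen_def pm_eval_single)

lemma map_matrix_DD_proj_gen: "map_matrix DD_proj (free_gen k) = DD_gen k"
  by (simp add: vec_eq_iff DD_proj_gen)

lemma surj_DD_proj: "surj (DD_proj :: 'n::{finite,linorder} free_alg \<Rightarrow> 'n DD)"
proof -
  note hom = unital_homD[OF unital_hom_DD_proj]
  have "\<exists>a. DD_proj a = f" for f :: "'n DD"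
  proof (induction f rule: cpoly_induct)
    case (const z)
    have "DD_proj (free_const (fps_const z)) = pconst z"
      by (simp add: DD_proj_const DD_const_def)
    thus ?case by blast
  next
    case (var a)
    obtain k j i where "dgen_index a = (k, j, i)" by (rule prod_cases3)
    hence "DD_proj (free_gen k $ j $ i) = pvar a"
      by (simp add: DD_proj_gen pvar_DD_gen)
    thus ?case by blast
  next
    case (add f g)
    thus ?case by (metis hom(3))
  next
    case (mult f g)
    thus ?case by (metis hom(6))
  qed
  thus ?thesis by (metis surjI)
qed


section \<open>Commutators in the twisted quantum Yangian\<close>

lemma ideal_gen_uminus: "x \<in> ideal_gen S \<Longrightarrow> - x \<in> ideal_gen S"
  using ideal_gen.left[of x S "- 1"] by simp

lemma ideal_gen_sum: "(\<And>a. a \<in> A \<Longrightarrow> f a \<in> ideal_gen S) \<Longrightarrow> sum f A \<in> ideal_gen S"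
  by (induction A rule: infinite_finite_induct) (auto intro: ideal_gen.zero ideal_gen.add)

lemma fls_nth_sum: "(\<Sum>a\<in>A. f a) $$ n = (\<Sum>a\<in>A. f a $$ n)"
  by (induction A rule: infinite_finite_induct) simp_all

text \<open>
  Each coefficient of a product of Laurent series is a finite sum, so multiplying by an arbitrary
  biseries, in particular by \<open>1/((\<lambda>-\<mu>)(\<lambda>\<^sup>-\<^sup>1-\<mu>))\<close>, does not leave the ideal.
\<close>

lemma ideal_gen_biseries_mult:
  assumes "\<And>m k. F $$ m $$ k \<in> ideal_gen S"
  shows "(W * F) $$ m $$ k \<in> ideal_gen S"
  by (simp add: fls_times_nth(2) fls_nth_sum) (intro ideal_gen_sum ideal_gen.left assms)

lemma yangian_ideal_relations:
  shows "RE_defect free_const free_gen $ a $ b $$ s $$ r \<in> yangian_ideal d"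
    and "j < i \<Longrightarrow> free_gen 0 $ i $ j \<in> yangian_ideal d"
    and "free_gen 0 $ i $ i - free_const d \<in> yangian_ideal d"
  unfolding yangian_ideal_def by (intro ideal_gen.base; blast)+

abbreviation hbar :: "'n::finite free_alg" where
  "hbar \<equiv> free_const fps_X"

lemma DD_proj_hbar: "DD_proj hbar = 0"
  by (simp add: DD_proj_const DD_const_def)

lemma RE_defect_free_expand:
  obtains Q :: "('n::{finite,linorder} free_alg biseries, 'n) mat2" where
    "RE_defect free_const (free_gen :: nat \<Rightarrow> ('n free_alg, 'n) mat1)
      = smat denom (G1 free_gen ** G2 free_gen - G2 free_gen ** G1 free_gen) + smat (biconst hbar) Q"
    "map_matrix (bimap DD_proj) Q = - smat denom (matrix_rhs DD_const DD_gen)"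
proof -
  have cent: "\<forall>c a. free_const c * a = a * (free_const c :: 'n free_alg)"
    using free_const_central by blast
  show thesis
    using RE_defect_expand[OF unital_hom_free_const cent unital_hom_DD_proj DD_proj_hbar
        unital_hom_DD_const, where G = free_gen] that
    unfolding map_matrix_DD_proj_gen by blast
qed

text \<open>
  Dividing the reflection equation by its invertible leading coefficient gives \<open>[x, y] = h c\<close> modulo the
  ideal, with \<open>c\<close> minus the corresponding coefficient of \<open>Q/denom\<close>.  Its classical value is then a
  coefficient of the matrix form of the bracket, hence of the entrywise form.
\<close>

lemma generator_commutator:
  fixes i j l p :: "'n::{finite,linorder}"
  shows "\<exists>c. free_gen k $ j $ i * free_gen m $ p $ l - free_gen m $ p $ l * free_gen k $ j $ i - hbar * c
      \<in> yangian_ideal d \<and> DD_proj c = entry_coeff DD_gen j i p l k m"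
proof -
  obtain Q :: "('n free_alg biseries, 'n) mat2" where
    RE: "RE_defect free_const (free_gen :: nat \<Rightarrow> ('n free_alg, 'n) mat1)
      = smat denom (G1 free_gen ** G2 free_gen - G2 free_gen ** G1 free_gen) + smat (biconst hbar) Q"
    and Q: "map_matrix (bimap DD_proj) Q = - smat denom (matrix_rhs DD_const DD_gen)"
    by (rule RE_defect_free_expand)
  note B = unital_homD[OF unital_hom_bimap[OF unital_hom_DD_proj]]
  define \<kappa> where "\<kappa> = (\<lambda>z. free_const (fps_const z) :: 'n free_alg)"
  have \<kappa>: "unital_hom \<kappa>"
    unfolding \<kappa>_def by (simp add: unital_hom_def unital_homD[OF unital_hom_free_const]
        flip: fps_const_add fps_const_mult)
  define W where "W = lift2 \<kappa> (1 / denom)"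
  define q where "q = Q $ (j, p) $ (i, l)"
  define F where "F = RE_defect free_const (free_gen :: nat \<Rightarrow> ('n free_alg, 'n) mat1) $ (j, p) $ (i, l)"
  define x y where "x = (\<lambda>k. free_gen k $ j $ i :: 'n free_alg)" and "y = (\<lambda>k. free_gen k $ p $ l :: 'n free_alg)"
  define c where "c = - (W * q) $$ int m $$ int k"
  have "central hbar"
    by (simp add: central_def free_const_central)
  hence "W * biconst hbar = biconst hbar * W"
    using central_biconst unfolding central_def by metis
  moreover have "F = denom * (ser_lam x * ser_mu y - ser_mu y * ser_lam x) + biconst hbar * q"
    unfolding F_def RE q_def x_def y_def by (simp add: G1_mult_G2 G2_mult_G1)
  ultimately have "W * F = (W * denom) * (ser_lam x * ser_mu y - ser_mu y * ser_lam x) + biconst hbar * (W * q)"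
    by (simp only: distrib_left mult.assoc[symmetric])
  also have "W * denom = 1"
    unfolding W_def by (rule denom_cancel(2)[OF \<kappa>])
  finally have "(W * F) $$ int m $$ int k = x k * y m - y m * x k - hbar * c"
    by (simp add: ser_lam_mult_ser_mu ser_mu_mult_ser_lam biser_nth biconst_mult_nth c_def)
  moreover have "(W * F) $$ int m $$ int k \<in> yangian_ideal d"
    using yangian_ideal_relations(1) unfolding F_def yangian_ideal_def
    by (intro ideal_gen_biseries_mult) 
  moreover have "DD_proj c = entry_coeff DD_gen j i p l k m"
  proof -
    have "DD_proj (\<kappa> z) = DD_const z" for z
      by (simp add: \<kappa>_def DD_proj_const)
    hence "bimap DD_proj W = lift2 DD_const (1 / denom)"
      unfolding W_def lift2_eq_bimap
      by (intro biseries_eqI)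
        (simp add: unital_homD(2)[OF \<kappa>] unital_homD(2)[OF unital_hom_DD_proj])
    moreover have "bimap DD_proj q = - (denom * matrix_rhs DD_const DD_gen $ (j, p) $ (i, l))"
      using arg_cong[OF Q, of "\<lambda>M. M $ (j, p) $ (i, l)"] by (simp add: q_def)
    ultimately have "bimap DD_proj (W * q)
        = - ((lift2 DD_const (1 / denom) * denom) * matrix_rhs DD_const DD_gen $ (j, p) $ (i, l))"
      by (simp only: B(6) mult_minus_right mult.assoc)
    also have "lift2 DD_const (1 / denom) * denom = (1 :: 'n DD biseries)"
      by (rule denom_cancel(2)[OF unital_hom_DD_const])
    finally have "bimap DD_proj (W * q) = - biser (entry_coeff DD_gen j i p l)"
      by (simp add: matrix_rhs_entry[OF unital_hom_DD_const] entry_rhs_biser[OF unital_hom_DD_const])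
    from arg_cong[OF this, of "\<lambda>F. F $$ int m $$ int k"] show ?thesis
      by (simp add: unital_homD[OF unital_hom_DD_proj] biser_nth c_def)
  qed
  ultimately show ?thesis
    unfolding x_def y_def by metis
qed

text \<open>
  The commutator and the bracket obey the same Leibniz rule in each argument, so the agreement on
  generators propagates to the whole algebra.
\<close>

lemma yangian_commutator:
  fixes a b :: "'n::{finite,linorder} free_alg"
  assumes pb: "DD_bracket pb"
  shows "\<exists>c. a * b - b * a - hbar * c \<in> yangian_ideal d \<and> pb (DD_proj a) (DD_proj b) = DD_proj c"
proof -
  note hom = unital_homD[OF unital_hom_DD_proj]
  note left = derivationD[OF DD_bracketD(2)[OF pb]]
  define Q where "Q = (\<lambda>a b :: 'n free_alg. \<exists>c. a * b - b * a - hbar * c \<in> yangian_ideal d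
    \<and> pb (DD_proj a) (DD_proj b) = DD_proj c)"
  have hc: "x * (hbar * y) = hbar * (x * y)" for x y :: "'n free_alg"
    by (metis free_const_central mult.assoc)
  have swap: "Q b a" if ab: "Q a b" for a b
  proof -
    obtain c where c: "a * b - b * a - hbar * c \<in> yangian_ideal d" "pb (DD_proj a) (DD_proj b) = DD_proj c"
      using ab unfolding Q_def by blast
    have "- (a * b - b * a - hbar * c) \<in> yangian_ideal d"
      using c(1) unfolding yangian_ideal_def by (rule ideal_gen_uminus)
    hence "b * a - a * b - hbar * (- c) \<in> yangian_ideal d"
      by (simp add: algebra_simps)
    moreover have "pb (DD_proj b) (DD_proj a) = DD_proj (- c)"
      using DD_bracketD(1)[OF pb, of "DD_proj b" "DD_proj a"] c(2) by (simp add: hom)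
    ultimately show ?thesis unfolding Q_def by blast
  qed
  have extend: "Q a b" if gens: "\<And>k i j. Q (free_gen k $ i $ j) b" for a b
  proof (induction a rule: free_alg_induct)
    case (const z)
    have "free_const z * b - b * free_const z - hbar * 0 \<in> yangian_ideal d"
      by (simp add: free_const_central yangian_ideal_def ideal_gen.zero)
    moreover have "pb (DD_proj (free_const z)) (DD_proj b) = DD_proj 0"
      by (simp add: DD_proj_const DD_const_def left(4) hom(2))
    ultimately show ?case unfolding Q_def by blast
  next
    case (gen k i j)
    show ?case by (rule gens)
  next
    case (add f g)
    then obtain c c' where c: "f * b - b * f - hbar * c \<in> yangian_ideal d" "pb (DD_proj f) (DD_proj b) = DD_proj c"
      "g * b - b * g - hbar * c' \<in> yangian_ideal d" "pb (DD_proj g) (DD_proj b) = DD_proj c'"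
      unfolding Q_def by blast
    have "(f + g) * b - b * (f + g) - hbar * (c + c') = (f * b - b * f - hbar * c) + (g * b - b * g - hbar * c')"
      by (simp add: algebra_simps)
    hence "(f + g) * b - b * (f + g) - hbar * (c + c') \<in> yangian_ideal d"
      using c unfolding yangian_ideal_def by (simp only: ideal_gen.add)
    moreover have "pb (DD_proj (f + g)) (DD_proj b) = DD_proj (c + c')"
      by (simp add: hom(3) left(1) c)
    ultimately show ?case unfolding Q_def by blast
  next
    case (mult f g)
    then obtain c c' where c: "f * b - b * f - hbar * c \<in> yangian_ideal d" "pb (DD_proj f) (DD_proj b) = DD_proj c"
      "g * b - b * g - hbar * c' \<in> yangian_ideal d" "pb (DD_proj g) (DD_proj b) = DD_proj c'"
      unfolding Q_def by blast
    have "f * g * b - b * (f * g) - hbar * (f * c' + c * g)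
        = f * (g * b - b * g - hbar * c') + (f * b - b * f - hbar * c) * g"
      by (simp add: algebra_simps hc)
    hence "f * g * b - b * (f * g) - hbar * (f * c' + c * g) \<in> yangian_ideal d"
      using c unfolding yangian_ideal_def by (simp only: ideal_gen.add ideal_gen.left ideal_gen.right)
    moreover have "pb (DD_proj (f * g)) (DD_proj b) = DD_proj (f * c' + c * g)"
      by (simp add: hom(3,6) left(3) c)
    ultimately show ?case unfolding Q_def by blast
  qed
  have gens: "Q (free_gen k $ j $ i) (free_gen m $ p $ l)" for k j i m p l
    unfolding Q_def DD_proj_gen DD_bracket_entry[OF pb] using generator_commutator[of k j i m p l d] by metis
  have "Q (free_gen k $ j $ i) b" for k j i b
    by (rule swap, rule extend, rule gens)
  hence "Q a b"
    by (rule extend)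
  thus ?thesis
    unfolding Q_def .
qed

text \<open>
  Over commuting generators and at \<open>h = 0\<close> the reflection equation is void, and the relations on
  \<open>\<A>\<^sup>(\<^sup>0\<^sup>)\<close> hold in \<open>\<DD>\<^sub>n\<close> by construction.
\<close>

lemma DD_proj_yangian_ideal:
  fixes a :: "'n::{finite,linorder} free_alg"
  assumes d: "fps_nth d 0 = 1" and a: "a \<in> yangian_ideal d"
  shows "DD_proj a = 0"
proof -
  note hom = unital_homD[OF unital_hom_DD_proj]
  have RE: "DD_proj (RE_defect free_const free_gen $ x $ y $$ s $$ r :: 'n free_alg) = 0" for x y s r
  proof -
    obtain Q :: "('n free_alg biseries, 'n) mat2" where
      RE: "RE_defect free_const (free_gen :: nat \<Rightarrow> ('n free_alg, 'n) mat1)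
        = smat denom (G1 free_gen ** G2 free_gen - G2 free_gen ** G1 free_gen) + smat (biconst hbar) Q"
      by (rule RE_defect_free_expand)
    have zero: "bimap DD_proj (biconst hbar) = (0 :: 'n DD biseries)"
      using DD_proj_hbar by (simp add: bimap_biconst hom(2)) (simp add: biconst_def)
    have "map_matrix (bimap DD_proj) (RE_defect free_const (free_gen :: nat \<Rightarrow> ('n free_alg, 'n) mat1)) = 0"
      unfolding RE map_matrix_hom[OF unital_hom_bimap[OF unital_hom_DD_proj]] zero
        map_matrix_G[OF unital_hom_DD_proj] G1_G2_commute
      by (simp add: smat_simps(6)) (simp add: vec_eq_iff)
    from arg_cong[OF this, of "\<lambda>M. M $ x $ y $$ s $$ r"] show ?thesis
      by (simp add: hom(2))
  qed
  from a show ?thesis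
    unfolding yangian_ideal_def
  proof induction
    case (base s)
    thus ?case
      using RE d by (auto simp: hom(4) DD_proj_gen DD_proj_const DD_gen_def DD_const_def)
  qed (simp_all add: hom)
qed


section \<open>The classical limit of the twisted quantum Yangian\<close>

text \<open>
  The ideal \<open>I + h A\<close>, to be identified with the kernel of the projection to \<open>\<DD>\<^sub>n\<close>.  The quotient by it
  is commutative by the commutator formula.
\<close>

definition mod_hbar :: "complex fps \<Rightarrow> 'n::{finite,linorder} free_alg set" where
  "mod_hbar d = {a. \<exists>b. a - hbar * b \<in> yangian_ideal d}"

lemma mod_hbar_arith:
  assumes "x \<in> mod_hbar d"
  shows "y \<in> mod_hbar d \<Longrightarrow> x + y \<in> mod_hbar d" "z * x \<in> mod_hbar d" "x * z \<in> mod_hbar d"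
proof -
  obtain b where b: "x - hbar * b \<in> yangian_ideal d"
    using assms by (auto simp: mod_hbar_def)
  have hc: "z * (hbar * b) = hbar * (z * b)"
    by (metis free_const_central mult.assoc)
  have "z * (x - hbar * b) \<in> yangian_ideal d" "(x - hbar * b) * z \<in> yangian_ideal d"
    using b unfolding yangian_ideal_def by (auto intro: ideal_gen.left ideal_gen.right)
  hence "z * x - hbar * (z * b) \<in> yangian_ideal d" "x * z - hbar * (b * z) \<in> yangian_ideal d"
    by (simp_all add: algebra_simps hc)
  thus "z * x \<in> mod_hbar d" "x * z \<in> mod_hbar d"
    by (auto simp: mod_hbar_def)
  assume "y \<in> mod_hbar d"
  then obtain b' where "y - hbar * b' \<in> yangian_ideal d"
    by (auto simp: mod_hbar_def)
  with b have "(x - hbar * b) + (y - hbar * b') \<in> yangian_ideal d"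
    unfolding yangian_ideal_def by (rule ideal_gen.add)
  hence "(x + y) - hbar * (b + b') \<in> yangian_ideal d"
    by (simp add: algebra_simps)
  thus "x + y \<in> mod_hbar d"
    by (auto simp: mod_hbar_def)
qed

lemma yangian_ideal_mod_hbar: "x \<in> yangian_ideal d \<Longrightarrow> x \<in> mod_hbar d"
  unfolding mod_hbar_def mem_Collect_eq by (rule exI[of _ 0]) simp

lemma mod_hbar_const:
  assumes "fps_nth c 0 = 0"
  shows "free_const c \<in> mod_hbar d"
proof -
  have "c = fps_X * fps_shift 1 c"
    using assms by (simp add: fps_eq_iff)
  hence "free_const c = hbar * free_const (fps_shift 1 c)"
    by (metis unital_homD(6)[OF unital_hom_free_const])
  hence eq: "free_const c - hbar * free_const (fps_shift 1 c) = 0"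
    by (simp only: right_minus_eq)
  have "0 \<in> yangian_ideal d"
    unfolding yangian_ideal_def by (rule ideal_gen.zero)
  thus ?thesis
    unfolding mod_hbar_def mem_Collect_eq by (intro exI[of _ "free_const (fps_shift 1 c)"]) (simp only: eq)
qed

lemma mod_hbar_commutator: "a * b - b * a \<in> mod_hbar d"
  using DD_bracket_exists yangian_commutator unfolding mod_hbar_def by blast

lemma mod_hbar_trans: "x - y \<in> mod_hbar d \<Longrightarrow> y - z \<in> mod_hbar d \<Longrightarrow> x - z \<in> mod_hbar d"
  using mod_hbar_arith(1)[of "x - y" d "y - z"] by simp

text \<open>
  Moving a letter to the front changes a word by a multiple of a commutator.
\<close>

lemma word_permute:
  "mset xs = mset ys \<Longrightarrow> word xs - word ys \<in> mod_hbar d"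
proof (induction xs arbitrary: ys)
  case Nil
  thus ?case
    using mod_hbar_commutator[of 1 1 d] by simp
next
  case (Cons x xs)
  hence "x \<in> set ys"
    by (metis list.set_intros(1) mset_eq_setD)
  then obtain us vs where ys: "ys = us @ x # vs"
    by (auto simp: in_set_conv_decomp)
  hence "word xs - word (us @ vs) \<in> mod_hbar d"
    using Cons.prems by (intro Cons.IH) simp
  hence 1: "word [x] * (word xs - word (us @ vs)) \<in> mod_hbar d"
    by (rule mod_hbar_arith)
  have 2: "(word [x] * word us - word us * word [x]) * word vs \<in> mod_hbar d"
    by (rule mod_hbar_arith(3)[OF mod_hbar_commutator])
  have "word (x # xs) - word ys = word [x] * (word xs - word (us @ vs))
      + (word [x] * word us - word us * word [x]) * word vs"
    unfolding ys word_append word_Cons[of x xs] word_Cons[of x vs] by (simp add: algebra_simps)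
  with mod_hbar_arith(1)[OF 1 2] show ?case
    by simp
qed

definition monomial_list :: "('g \<Rightarrow>\<^sub>0 nat) \<Rightarrow> 'g list" where
  "monomial_list m = (SOME xs. mset xs = Abs_multiset (Poly_Mapping.lookup m))"

lemma count_monomial_list: "count (mset (monomial_list m)) = Poly_Mapping.lookup m"
proof -
  have "mset (monomial_list m) = Abs_multiset (Poly_Mapping.lookup m)"
    unfolding monomial_list_def by (rule someI_ex) (rule ex_mset)
  thus ?thesis
    by (simp add: Abs_multiset_inverse)
qed

lemma monomial_list_0: "monomial_list 0 = []"
proof -
  have "mset (monomial_list 0) = {#}"
    by (rule multiset_eqI) (simp add: count_monomial_list)
  thus ?thesis by simp
qed

lemma mset_monomial_list_add:
  "mset (monomial_list (Poly_Mapping.single a 1 + m)) = mset (a # monomial_list m)"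
  by (rule multiset_eqI) (simp add: count_monomial_list lookup_add lookup_single when_def)

text \<open>
  A linear section of the projection: each monomial is sent to one chosen word with these letters.
  It is multiplicative only modulo \<open>I + h A\<close>, where the order of the letters is immaterial.
\<close>

definition DD_section :: "'n::{finite,linorder} DD \<Rightarrow> 'n free_alg" where
  "DD_section = pm_eval (\<lambda>z. free_const (fps_const z)) (\<lambda>m. word (map dgen_index (monomial_list m)))"

lemma unital_hom_free_fps_const: "unital_hom (\<lambda>z. free_const (fps_const z))"
  by (simp add: unital_hom_def unital_homD[OF unital_hom_free_const] flip: fps_const_add fps_const_mult)

lemma DD_section_add: "DD_section (f + g) = DD_section f + DD_section g"
  unfolding DD_section_def by (rule pm_eval_add[OF unital_hom_free_fps_const])

lemma DD_section_single:
  "DD_section (Poly_Mapping.single m z) = free_const (fps_const z) * word (map dgen_index (monomial_list m))"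
  unfolding DD_section_def using unital_homD(2)[OF unital_hom_free_fps_const] by (rule pm_eval_single)

text \<open>
  Modulo \<open>I + h A\<close>, multiplication by a letter matches multiplication by its image: for a free
  generator this is a rearrangement of letters, and the letters of \<open>\<A>\<^sup>(\<^sup>0\<^sup>)\<close> on or below the diagonal are
  congruent to \<open>1\<close> or \<open>0\<close>.
\<close>

lemma DD_section_letter:
  assumes d: "fps_nth d 0 = 1"
  shows "word [x] * DD_section f - DD_section (DD_proj (word [x]) * f) \<in> mod_hbar d"
proof -
  obtain k j i where x: "x = (k, j, i)" by (rule prod_cases3)
  have zero: "0 \<in> mod_hbar d"
    using mod_hbar_commutator[of 1 1 d] by simp
  have section_0: "DD_section 0 = 0"
    by (simp add: DD_section_def pm_eval_def)
  have proj: "DD_proj (word [x]) = DD_gen k $ j $ i"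
    by (simp add: x DD_proj_gen flip: free_gen_word)
  consider a where "dgen_index a = x" "DD_gen k $ j $ i = pvar a" | "k = 0" "i < j" | "k = 0" "i = j"
    unfolding x by (cases k j i rule: DD_gen_cases) (auto simp: le_less)
  thus ?thesis
  proof cases
    case a: 1
    show ?thesis
    proof (induction f rule: poly_mapping_induct_single)
      case (single m z)
      have "word (x # map dgen_index (monomial_list m))
          - word (map dgen_index (monomial_list (Poly_Mapping.single a 1 + m))) \<in> mod_hbar d"
        by (rule word_permute) (simp only: mset_map mset_monomial_list_add list.map mset.simps a image_mset_add_mset)
      hence "free_const (fps_const z) * (word (x # map dgen_index (monomial_list m))
          - word (map dgen_index (monomial_list (Poly_Mapping.single a 1 + m)))) \<in> mod_hbar d"
        by (rule mod_hbar_arith)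
      moreover have "pvar a * Poly_Mapping.single m z = Poly_Mapping.single (Poly_Mapping.single a 1 + m) z"
        by (simp add: pvar_def mult_single)
      ultimately show ?case
        unfolding proj a(2) DD_section_single word_Cons[of x "map _ _"]
        by (simp add: DD_section_single right_diff_distrib free_const_central mult.assoc flip: One_nat_def)
    next
      case (add f g)
      from mod_hbar_arith(1)[OF add] show ?case
        by (simp add: DD_section_add distrib_left algebra_simps)
    qed
  next
    case 2
    have "word [x] \<in> mod_hbar d"
      using yangian_ideal_relations(2)[OF 2(2), of d] 2(1) unfolding x free_gen_word
      by (intro yangian_ideal_mod_hbar) simp
    moreover have "DD_gen k $ j $ i = 0"
      using 2 by (auto simp: DD_gen_def)
    ultimately show ?thesis
      by (simp add: proj section_0 mod_hbar_arith)
  next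
    case 3
    have "word [x] - free_const d \<in> mod_hbar d"
      using yangian_ideal_relations(3)[of j d] 3 unfolding x free_gen_word
      by (intro yangian_ideal_mod_hbar) simp
    moreover have "free_const (d - 1) \<in> mod_hbar d"
      using d by (intro mod_hbar_const) simp
    ultimately have "word [x] - 1 \<in> mod_hbar d"
      using mod_hbar_arith(1) by (fastforce simp: unital_homD[OF unital_hom_free_const])
    hence "(word [x] - 1) * DD_section f \<in> mod_hbar d"
      by (rule mod_hbar_arith)
    moreover have "DD_gen k $ j $ i = 1"
      using 3 by (auto simp: DD_gen_def)
    ultimately show ?thesis
      by (simp add: proj left_diff_distrib)
  qed
qed

text \<open>
  Every element is congruent to the section of its image, so an element of the kernel of the
  projection is congruent to \<open>0\<close>.  This is the inclusion that says that \<open>\<DD>\<^sub>n\<close> is the whole classical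
  limit and not only a quotient of it.
\<close>

lemma DD_section_proj:
  fixes a :: "'n::{finite,linorder} free_alg"
  assumes d: "fps_nth d 0 = 1"
  shows "a - DD_section (DD_proj a) \<in> mod_hbar d"
proof (induction a rule: poly_mapping_induct_single)
  case (single w c)
  note hom = unital_homD[OF unital_hom_DD_proj]
  have section_scale: "DD_section (DD_const z * f) = free_const (fps_const z) * DD_section f" for z and f :: "'n DD"
  proof (induction f rule: poly_mapping_induct_single)
    case (single m z')
    show ?case
      unfolding DD_const_def mult_single DD_section_single
      by (simp add: unital_homD(6)[OF unital_hom_free_fps_const] mult.assoc)
  qed (simp add: distrib_left DD_section_add)
  have words: "word xs - DD_section (DD_proj (word xs)) \<in> mod_hbar d" for xs :: "(nat \<times> 'n \<times> 'n) list"
  proof (induction xs)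
    case Nil
    have "DD_section 1 = (1 :: 'n free_alg)"
      using DD_section_single[of 0 1] by (simp add: monomial_list_0 word_Nil unital_homD[OF unital_hom_free_const])
    thus ?case
      using mod_hbar_commutator[of 1 1 d] by (simp add: word_Nil hom)
  next
    case (Cons x xs)
    have "word [x] * (word xs - DD_section (DD_proj (word xs))) \<in> mod_hbar d"
      by (rule mod_hbar_arith(2)[OF Cons])
    hence "word (x # xs) - word [x] * DD_section (DD_proj (word xs)) \<in> mod_hbar d"
      by (simp add: word_Cons[of x xs] right_diff_distrib)
    from mod_hbar_trans[OF this DD_section_letter[OF d]] show ?case
      by (simp only: word_Cons[of x xs] hom(6))
  qed
  define u where "u = word (letters w)"
  define c0 where "c0 = fps_const (fps_nth c 0)"
  have "free_const (c - c0) * u \<in> mod_hbar d"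
    by (intro mod_hbar_arith(3) mod_hbar_const) (simp add: c0_def)
  hence 1: "free_const c * u - free_const c0 * u \<in> mod_hbar d"
    by (simp add: unital_homD(4)[OF unital_hom_free_const] left_diff_distrib)
  have "free_const c0 * (u - DD_section (DD_proj u)) \<in> mod_hbar d"
    unfolding u_def by (rule mod_hbar_arith(2)[OF words])
  hence 2: "free_const c0 * u - free_const c0 * DD_section (DD_proj u) \<in> mod_hbar d"
    by (simp add: right_diff_distrib)
  have "DD_section (DD_proj (free_const c * u)) = free_const c0 * DD_section (DD_proj u)"
    by (simp add: hom(6) DD_proj_const section_scale c0_def)
  with mod_hbar_trans[OF 1 2] show ?case
    unfolding free_alg_single u_def[symmetric] by simp
next
  case (add f g)
  have "DD_section (DD_proj (f + g)) = DD_section (DD_proj f) + DD_section (DD_proj g)"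
    by (simp add: unital_homD(3)[OF unital_hom_DD_proj] DD_section_add)
  with mod_hbar_arith(1)[OF add] show ?case
    by (simp add: algebra_simps)
qed

theorem yangian_semiclassical_limit:
  assumes pb: "DD_bracket pb" and d: "fps_nth d 0 = 1"
  shows "semiclassical_limit free_const (yangian_ideal d) DD_proj pb"
proof -
  have "DD_proj a = 0 \<longleftrightarrow> (\<exists>b. a - hbar * b \<in> yangian_ideal d)" for a
  proof
    assume "DD_proj a = 0"
    with DD_section_proj[OF d, of a] show "\<exists>b. a - hbar * b \<in> yangian_ideal d"
      by (simp add: mod_hbar_def DD_section_def pm_eval_def)
  next
    assume "\<exists>b. a - hbar * b \<in> yangian_ideal d"
    then obtain b where "DD_proj (a - hbar * b) = 0"
      using DD_proj_yangian_ideal[OF d] by blast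
    thus "DD_proj a = 0"
      by (simp add: unital_homD[OF unital_hom_DD_proj] DD_proj_hbar)
  qed
  thus ?thesis
    unfolding semiclassical_limit_def
    using unital_hom_DD_proj surj_DD_proj yangian_commutator[OF pb] by blast
qed

theorem mainTheorem2:
  shows
    "(\<forall>l m :: complex fps biseries.
        O_h id 2 ((R id l m :: (complex fps biseries, 'n::{finite,linorder}) mat2)
                  - (smat (l - m) (mat 1 \<otimes> mat 1) + smat (biconst fps_X) (rmat l m))))
   \<and> (\<forall>(\<iota> :: complex fps \<Rightarrow> 'a::ring_1) (\<pi> :: 'a \<Rightarrow> 'b::comm_ring_1) (G :: nat \<Rightarrow> ('a, 'n) mat1).
        flat_deformation \<iota> \<pi> \<longrightarrow>
        (O_h \<iota> 2 (RE_defect \<iota> G) \<longleftrightarrow>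
           bracket_mat (induced_bracket \<iota> \<pi>) (\<lambda>k. map_matrix \<pi> (G k))
           = matrix_rhs (\<lambda>c. \<pi> (\<iota> (fps_const c))) (\<lambda>k. map_matrix \<pi> (G k))))
   \<and> (\<forall>(\<kappa> :: complex \<Rightarrow> 'b) (g :: nat \<Rightarrow> ('b, 'n) mat1). unital_hom \<kappa> \<longrightarrow>
        (\<forall>j i p l. matrix_rhs \<kappa> g $ (j, p) $ (i, l) = entry_rhs \<kappa> g j i p l))
   \<and> (\<exists>!pb :: 'n DD \<Rightarrow> 'n DD \<Rightarrow> 'n DD. DD_bracket pb)
   \<and> (\<forall>(pb :: 'n DD \<Rightarrow> 'n DD \<Rightarrow> 'n DD) (d :: complex fps).
        DD_bracket pb \<and> fps_nth d 0 = 1 \<longrightarrow>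
        (\<exists>\<pi> :: 'n free_alg \<Rightarrow> 'n DD.
           (\<forall>c. \<pi> (free_const c) = DD_const (fps_nth c 0)) \<and>
           (\<forall>k. map_matrix \<pi> (free_gen k) = DD_gen k) \<and>
           semiclassical_limit free_const (yangian_ideal d) \<pi> pb))"
proof (intro conjI allI impI)
  show "\<exists>!pb :: 'n DD \<Rightarrow> 'n DD \<Rightarrow> 'n DD. DD_bracket pb"
    by (rule ex_ex1I[OF DD_bracket_exists DD_bracket_unique])
next
  fix pb :: "'n DD \<Rightarrow> 'n DD \<Rightarrow> 'n DD" and d :: "complex fps"
  assume "DD_bracket pb \<and> fps_nth d 0 = 1"
  hence "semiclassical_limit free_const (yangian_ideal d) DD_proj pb"
    by (blast intro: yangian_semiclassical_limit)
  thus "\<exists>\<pi> :: 'n free_alg \<Rightarrow> 'n DD. (\<forall>c. \<pi> (free_const c) = DD_const (fps_nth c 0)) \<and>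
      (\<forall>k. map_matrix \<pi> (free_gen k) = DD_gen k) \<and> semiclassical_limit free_const (yangian_ideal d) \<pi> pb"
    by (intro exI[of _ DD_proj] conjI allI DD_proj_const map_matrix_DD_proj_gen)
qed (rule R_second_order reflection_equation_order_h matrix_rhs_entry; assumption?)+

end
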